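(* There exist universal constants $C,c>0$ such that the following three statements hold for all $n\in\mathbb{N}$, all even $k\in\mathbb{N}$ and all $0<p<1$, where $N=np(1-p)-1$. 1. For every $m>0$ there exists $N_0=N_0(m)$ (depending only on $m$) such that if $N>N_0$ and $k\le(\log N)^m$, then $$M(n,k,p)\ge\frac ck\,\tilde M(n,k,p).$$ 2. For every $0<\beta<1$ there exist $c(\beta)>0$ and $N_0=N_0(\beta)$ (depending only on $\beta$) such that if $N>N_0$ and $k\le N^\beta$, then $$M(n,k,p)\ge c\exp\left(-\frac{k}{\exp\left(c(\beta)\sqrt{\log(k)\,\log\log(2k)}\right)}\right)\tilde M(n,k,p).$$ 3. If $k\le cN$, then $$M(n,k,p)\ge c\,e^{-Ck}\,\tilde M(n,k,p).$$
   Context: $\mathbb{N}$ denotes the positive integers and $\log$ the natural logarithm. $\mathrm{Bin}(n,p)$ is the Binomial distribution. For $n,k\in\mathbb{N}$ and $0<p<1$, $\mathcal{A}(n,k,p)$ is the set of all probability distributions of $(X_1,\dots,X_n)$ on $\{0,1\}^n$ that are $k$-wise independent with identical marginals $p$, i.e. $\mathbb{P}(X_i=1\ \forall i\in S)=p^{|S|}$ for all $S\subseteq\{1,\dots,n\}$ with $|S|\le k$. Define $$M(n,k,p)=\max_{\mathbb{Q}\in\mathcal{A}(n,k,p)}\mathbb{Q}(X_1=\dots=X_n=1).$$ $\tilde M(n,k,p)$ is defined as the maximum of $\mathbb{P}(S=n)$ over all real random variables $S$ supported on $[0,n]$ with $\mathbb{E}S^i=\mathbb{E}X^i$ for $1\le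 i\le k$, where $X\sim\mathrm{Bin}(n,p)$. For even $k$ it is known that $$\tilde M(n,k,p)=\frac{p^n}{\mathbb{P}\left(\mathrm{Bin}(n,1-p)\le \frac k2\right)}.$$ *)

theory Defs
  imports "HOL-Probability.Probability"
begin

text \<open>
  Laws of \<open>(X\<^sub>1, \<dots>, X\<^sub>n)\<close> on \<open>{0,1}\<^sup>n\<close>, with \<open>{0,1}\<^sup>n\<close> rendered as the extensional functions
  from \<open>{1..n}\<close> to \<open>{0,1}\<close>. The condition on singletons gives the identical marginals.
\<close>

definition kwise_laws :: "nat \<Rightarrow> nat \<Rightarrow> real \<Rightarrow> (nat \<Rightarrow> nat) pmf set" where
  "kwise_laws n k p =
     {Q. set_pmf Q \<subseteq> {1..n} \<rightarrow>\<^sub>E {0, 1} \<and>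
         (\<forall>S. S \<subseteq> {1..n} \<and> card S \<le> k \<longrightarrow>
            measure_pmf.prob Q {x. \<forall>i\<in>S. x i = 1} = p ^ card S)}"

text \<open>
  The maximum is rendered as the supremum of the values; it is attained because
  \<open>kwise_laws n k p\<close> is a compact polytope, which is nonempty for \<open>0 < p < 1\<close>.
\<close>

definition max_all_ones :: "nat \<Rightarrow> nat \<Rightarrow> real \<Rightarrow> real" where
  "max_all_ones n k p =
     (SUP Q\<in>kwise_laws n k p. measure_pmf.prob Q {x. \<forall>i\<in>{1..n}. x i = 1})"

text \<open>
  Instead of random variables \<open>S\<close> on arbitrary probability spaces we range over their laws on the
  real line: the support, the moments and the probability of \<open>S = n\<close> depend on the law only, and
  every law is that of some random variable. The moments are finite because of the support.
\<close>

definition moment_laws :: "nat \<Rightarrow> nat \<Rightarrow> real \<Rightarrow> real measure set" where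
  "moment_laws n k p =
     {D. real_distribution D \<and> (AE s in D. s \<in> {0..real n}) \<and>
         (\<forall>i\<in>{1..k}. (LINT s|D. s ^ i) =
            measure_pmf.expectation (binomial_pmf n p) (\<lambda>x. real x ^ i))}"

text \<open>
  Again a supremum for a maximum, attained since the laws on \<open>{0..n}\<close> with prescribed moments form
  a weakly compact set on which the mass of the closed set \<open>{n}\<close> is upper semicontinuous.
\<close>

definition max_top_mass :: "nat \<Rightarrow> nat \<Rightarrow> real \<Rightarrow> real" where
  "max_top_mass n k p = (SUP D\<in>moment_laws n k p. measure D {real n})"

lemma bdd_above_kwise_laws:
  "bdd_above ((\<lambda>Q. measure_pmf.prob Q {x. \<forall>i\<in>{1..n}. x i = 1}) ` kwise_laws n k p)"
  by (rule bdd_aboveI[of _ 1]) auto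

lemma bdd_above_moment_laws: "bdd_above ((\<lambda>D. measure D {real n}) ` moment_laws n k p)"
  by (rule bdd_aboveI[of _ 1])
     (auto simp: moment_laws_def real_distribution_def prob_space.prob_le_1)

lemma kwise_laws_nonempty:
  assumes "0 < p" "p < 1"
  shows "kwise_laws n k p \<noteq> {}"
proof -
  let ?B = "map_pmf (of_bool :: bool \<Rightarrow> nat) (bernoulli_pmf p)"
  let ?Q = "Pi_pmf {1..n} undefined (\<lambda>_. ?B)"
  have 1: "set_pmf ?Q \<subseteq> {1..n} \<rightarrow>\<^sub>E {0, 1}"
  proof -
    have "set_pmf ?Q = PiE_dflt {1..n} undefined (\<lambda>_. set_pmf ?B)"
      by (subst set_Pi_pmf) (auto simp: o_def)
    also have "\<dots> \<subseteq> {1..n} \<rightarrow>\<^sub>E {0, 1}"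
      by (fastforce simp: PiE_dflt_def PiE_def extensional_def Pi_def)
    finally show ?thesis .
  qed
  have 2: "measure_pmf.prob ?Q {x. \<forall>i\<in>S. x i = 1} = p ^ card S" if S: "S \<subseteq> {1..n}" for S
  proof -
    have fin: "finite S" using S finite_subset by blast
    let ?A = "\<lambda>i. if i \<in> S then {1} else UNIV :: nat set"
    have pB: "measure_pmf.prob ?B {1} = p"
    proof -
      have "(of_bool :: bool \<Rightarrow> nat) -` {1} = {True}"
        by (auto simp: of_bool_def split: if_splits)
      then show ?thesis using assms
        by (simp only: measure_map_pmf) (simp add: measure_pmf_single)
    qed
    have eq: "{x. \<forall>i\<in>S. x i = 1} = {x :: nat \<Rightarrow> nat. \<forall>i\<in>{1..n}. x i \<in> ?A i}"
      using S by auto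
    have "measure_pmf.prob ?Q {x. \<forall>i\<in>S. x i = 1} =
            measure_pmf.prob ?Q (Pi {1..n} ?A)"
      unfolding eq by (rule arg_cong[where f = "measure_pmf.prob ?Q"]) (auto simp: Pi_def)
    also have "\<dots> = (\<Prod>i\<in>{1..n}. measure_pmf.prob ?B (?A i))"
      by (rule measure_Pi_pmf_Pi) auto
    also have "\<dots> = (\<Prod>i\<in>{1..n}. if i \<in> S then p else 1)"
      using pB by (intro prod.cong) auto
    also have "\<dots> = p ^ card S"
      using S by (simp add: prod.If_cases Int_absorb1)
    finally show ?thesis .
  qed
  from 1 2 have "?Q \<in> kwise_laws n k p" by (simp add: kwise_laws_def)
  then show ?thesis by blast
qed

lemma moment_laws_nonempty:
  assumes "0 < p" "p < 1"
  shows "moment_laws n k p \<noteq> {}"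
proof -
  let ?D = "distr (binomial_pmf n p) borel real"
  have "real_distribution ?D"
    by (intro real_distribution.intro real_distribution_axioms.intro measure_pmf.prob_space_distr)
       auto
  moreover have "AE s in ?D. s \<in> {0..real n}"
    using assms by (subst AE_distr_iff) (auto simp: AE_measure_pmf_iff set_pmf_binomial)
  moreover have "(LINT s|?D. s ^ i) =
      measure_pmf.expectation (binomial_pmf n p) (\<lambda>x. real x ^ i)" for i
    by (rule integral_distr) auto
  ultimately have "?D \<in> moment_laws n k p" by (simp add: moment_laws_def)
  then show ?thesis by blast
qed

end

theory Submission
  imports Defs "HOL-Real_Asymp.Real_Asymp"
begin

text \<open>
  The two maxima turn out to be within a factor of order \<open>k\<close> of each other as soon as
  \<open>k \<le> n * p\<close>, and each of the three statements is a weakening of this: for suitable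
  constants, \<open>1 / (2 * k)\<close> dominates the three claimed factors.

  By symmetry, the maximum over \<open>k\<close>-wise independent laws is the maximum of \<open>Q {n}\<close> over laws
  \<open>Q\<close> on the integers \<open>{0..n}\<close> that share \<open>k\<close> moments with the binomial law \<open>\<mu>\<close>. A basic optimal
  solution of this linear program lives on \<open>n\<close> and on \<open>k\<close> integers \<open>Z\<close> below \<open>n\<close> for which
  \<open>f s = (\<Prod>z\<in>Z. s - z)\<close> is nonnegative on \<open>{0..n}\<close>, and its mass at \<open>n\<close> is
  \<open>(\<Sum>s\<le>n. \<mu> s * f s) / f n\<close> (\<open>extremal_quadrature\<close>). Since \<open>f\<close> does not change sign on the
  integers, \<open>Z\<close> splits into adjacent pairs \<open>{y, y + 1}\<close> (\<open>zeros_in_adjacent_pairs\<close>).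

  Put \<open>q x = (\<Prod>y. x - y - 1/2)\<close>, the product over the midpoints of the pairs. It has degree
  \<open>k / 2\<close>, so every law on \<open>[0, n]\<close> with the right moments gives \<open>n\<close> at most the mass
  \<open>(\<Sum>s\<le>n. \<mu> s * (q s)\<^sup>2) / (q n)\<^sup>2\<close> (\<open>max_top_mass_le\<close>). It remains to compare \<open>\<Sum>s\<le>n. \<mu> s * (q s)\<^sup>2\<close>
  with \<open>\<Sum>s\<le>n. \<mu> s * f s\<close>. Away from \<open>Z\<close>, the pairs being disjoint, \<open>(q s)\<^sup>2\<close> exceeds \<open>f s\<close>
  by a bounded factor only (\<open>midpoint_square_le\<close>). On \<open>Z\<close> the polynomial \<open>f\<close> vanishes and \<open>q\<close>
  does not, so the values of \<open>\<mu> * q\<^sup>2\<close> on \<open>Z\<close> have to be controlled by its values off \<open>Z\<close>.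

  Here the form of the binomial weights helps: up to a constant, \<open>\<mu> s\<close> is \<open>r ^ s\<close> divided by
  the product of the distances from \<open>s\<close> to all other points of \<open>{0..n}\<close>, where \<open>r = p / (1 - p)\<close>.
  The factors that belong to \<open>Z\<close> cancel against \<open>f\<close> or \<open>q\<^sup>2\<close>, and what is left is, up to
  constants, \<open>r ^ s\<close> divided by the product of the distances from \<open>s\<close> to the points of
  \<open>F = {0..n} - Z\<close>. In a gap of \<open>F\<close> the factors of the points outside the gap form a log-convex
  function, which is largest at an end of the gap (\<open>weight_in_gap_le\<close>). A gap that contains \<open>0\<close> has
  a right end only, and there \<open>k \<le> n * r\<close> makes this end dominate
  (\<open>weight_below_minimum_le\<close>). So each of the \<open>k\<close> points of \<open>Z\<close> contributes at most a constant times the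
  sum over \<open>F\<close>, which is the origin of the factor \<open>k\<close>.
\<close>

section \<open>Extremal quadrature on the integers\<close>

definition lagrange_basis :: "nat set \<Rightarrow> nat \<Rightarrow> real \<Rightarrow> real" where
  "lagrange_basis T y x = (\<Prod>z\<in>T - {y}. (x - real z) / (real y - real z))"

lemma lagrange_basis_node:
  assumes "finite T" "x \<in> T" "y \<in> T"
  shows "lagrange_basis T y (real x) = (if x = y then 1 else 0)"
proof (cases "x = y")
  case True
  then show ?thesis by (auto simp: lagrange_basis_def intro!: prod.neutral)
next
  case False
  with assms have "(\<Prod>z\<in>T - {y}. (real x - real z) / (real y - real z)) = 0"
    by (intro prod_zero) auto
  with False show ?thesis by (simp add: lagrange_basis_def)
qed

lemma lagrange_interpolation:
  fixes P :: "real poly"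
  assumes fin: "finite T" and deg: "degree P < card T"
  shows "poly P x = (\<Sum>y\<in>T. poly P (real y) * lagrange_basis T y x)"
proof -
  define L where "L y = (\<Prod>z\<in>T - {y}. smult (1 / (real y - real z)) [:- real z, 1:])" for y
  have poly_L: "poly (L y) x = lagrange_basis T y x" for y x
    by (simp add: L_def lagrange_basis_def poly_prod diff_divide_distrib)
  define R where "R = (\<Sum>y\<in>T. smult (poly P (real y)) (L y))"
  have deg_L: "degree (L y) \<le> card T - 1" if "y \<in> T" for y
  proof -
    have "degree (L y) \<le> (\<Sum>z\<in>T - {y}. degree (smult (1 / (real y - real z)) [:- real z, 1:]))"
      unfolding L_def by (rule order.trans[OF degree_prod_sum_le]) (use fin in \<open>auto simp: o_def\<close>)
    also have "\<dots> \<le> (\<Sum>z\<in>T - {y}. 1)"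
      by (intro sum_mono) simp
    finally show ?thesis using that fin by simp
  qed
  have "degree R \<le> card T - 1"
    unfolding R_def using deg_L by (intro degree_sum_le fin) (auto intro: order.trans[OF degree_smult_le])
  then have deg_R: "degree R < card T" using deg by linarith
  have card: "card (real ` T) = card T" by (simp add: card_image)
  have "P = R"
  proof (rule poly_eqI_degree[where A = "real ` T"])
    fix x assume "x \<in> real ` T"
    then obtain t where t: "t \<in> T" "x = real t" by auto
    have "poly R x = (\<Sum>y\<in>T. poly P (real y) * (if t = y then 1 else 0))"
      unfolding R_def poly_sum
      using t fin by (intro sum.cong) (auto simp: poly_L lagrange_basis_node)
    then show "poly P x = poly R x" using t fin by (simp add: if_distrib sum.delta cong: if_cong)
  qed (use deg deg_R card in auto)
  then have "poly P x = poly R x" by simp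
  then show ?thesis by (simp add: R_def poly_sum poly_L)
qed

text \<open>
  This is the optimal basis of the linear program that maximises the mass at \<open>n\<close> of a law on
  \<open>{0..n}\<close> with \<open>k\<close> moments prescribed by \<open>\<mu>\<close>. Among the finitely many sets \<open>Z\<close> whose polynomial is
  nonnegative on \<open>{0..n}\<close>, one takes a set that minimises the \<open>\<mu>\<close>-sum of this polynomial,
  normalised to be \<open>1\<close> at \<open>n\<close>. A negative quadrature weight at some \<open>z \<in> Z\<close> would allow a pivot step
  of the simplex method, which exchanges \<open>z\<close> for another node and decreases this sum.
\<close>

lemma extremal_quadrature:
  fixes \<mu> :: "nat \<Rightarrow> real"
  assumes \<mu>: "\<And>s. s \<le> n \<Longrightarrow> \<mu> s \<ge> 0" and k: "k \<le> n"
  obtains Z where "Z \<subseteq> {..<n}" "card Z = k"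
    "\<And>s. s \<le> n \<Longrightarrow> (\<Prod>z\<in>Z. real s - real z) \<ge> 0"
    "\<And>x. x \<in> insert n Z \<Longrightarrow> (\<Sum>s\<le>n. \<mu> s * lagrange_basis (insert n Z) x (real s)) \<ge> 0"
proof -
  define f where "f Z s = (\<Prod>z\<in>Z. real s - real z)" for Z and s :: nat
  define E where "E g = (\<Sum>s\<le>n. \<mu> s * g s)" for g :: "nat \<Rightarrow> real"
  define val where "val Z = E (\<lambda>s. f Z s / f Z n)" for Z
  define \<Z> where "\<Z> = {Z. Z \<subseteq> {..<n} \<and> card Z = k \<and> (\<forall>s\<le>n. f Z s \<ge> 0)}"
  have "finite \<Z>"
    by (rule finite_subset[of _ "Pow {..<n}"]) (auto simp: \<Z>_def)
  moreover have "{..<k} \<in> \<Z>"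
  proof -
    have "f {..<k} s \<ge> 0" for s
    proof (cases "s < k")
      case True
      then have "f {..<k} s = 0" unfolding f_def by (intro prod_zero) auto
      then show ?thesis by simp
    qed (auto simp: f_def intro!: prod_nonneg)
    then show ?thesis using k by (auto simp: \<Z>_def)
  qed
  ultimately obtain Z where Z: "Z \<in> \<Z>" and min: "\<And>Z'. Z' \<in> \<Z> \<Longrightarrow> val Z \<le> val Z'"
    using ex_min_if_finite[of "val ` \<Z>"] by (fastforce simp: not_less)
  have Zn: "Z \<subseteq> {..<n}" and cZ: "card Z = k" and fZ: "\<And>s. s \<le> n \<Longrightarrow> f Z s \<ge> 0"
    using Z by (auto simp: \<Z>_def)
  have fin: "finite Z" using Zn finite_subset by blast
  have n_notin: "n \<notin> Z" using Zn by auto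
  have f_n: "f Z' n > 0" if "Z' \<subseteq> {..<n}" for Z'
    unfolding f_def using that by (intro prod_pos) auto
  define basis where "basis x s = lagrange_basis (insert n Z) x (real s)" for x s
  have E_mono: "E g \<ge> 0" if "\<And>s. s \<le> n \<Longrightarrow> g s \<ge> 0" for g
    unfolding E_def using that \<mu> by (intro sum_nonneg mult_nonneg_nonneg) auto
  have nonneg_n: "E (basis n) \<ge> 0"
  proof (rule E_mono)
    fix s assume "s \<le> n"
    have "basis n s = f Z s / f Z n"
      using n_notin by (simp add: basis_def lagrange_basis_def f_def prod_dividef)
    then show "basis n s \<ge> 0" using fZ[OF \<open>s \<le> n\<close>] f_n[OF Zn] by simp
  qed
  have nonneg_Z: "E (basis z) \<ge> 0" if z: "z \<in> Z" for z
  proof (rule ccontr)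
    assume neg: "\<not> E (basis z) \<ge> 0"
    define N where "N = {s. s \<le> n \<and> basis z s < 0}"
    have "finite N" by (simp add: N_def)
    have "N \<noteq> {}" using neg E_mono[of "basis z"] by (force simp: N_def not_less)
    have node: "basis z x = (if x = z then 1 else 0)" if "x \<in> insert n Z" for x
      using lagrange_basis_node[of "insert n Z" x z] that z fin by (simp add: basis_def)
    have N_free: "s < n \<and> s \<notin> Z" if "s \<in> N" for s
      using that node[of s] node[of n] z
      by (cases "s \<in> insert n Z") (auto simp: N_def split: if_splits)
    have f_pos: "f Z s > 0" if "s \<in> N" for s
    proof -
      have "f Z s \<noteq> 0" unfolding f_def using N_free[OF that] fin by (auto simp: prod_zero_iff)
      moreover have "f Z s \<ge> 0" using that fZ by (simp add: N_def)
      ultimately show ?thesis by simp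
    qed
    \<comment> \<open>Raise the multiple \<open>t\<close> of the basis polynomial of \<open>z\<close> added to \<open>f / f n\<close> until a new zero \<open>s0\<close> appears.\<close>
    define \<tau> where "\<tau> s = f Z s / f Z n / (- basis z s)" for s
    obtain s0 where s0: "s0 \<in> N" and s0_min: "\<And>s. s \<in> N \<Longrightarrow> \<tau> s0 \<le> \<tau> s"
      using ex_min_if_finite[of "\<tau> ` N"] \<open>finite N\<close> \<open>N \<noteq> {}\<close> by (fastforce simp: not_less)
    define t where "t = \<tau> s0"
    have t_pos: "t > 0"
      unfolding t_def \<tau>_def using s0 f_pos[OF s0] f_n[OF Zn]
      by (intro divide_pos_pos) (auto simp: N_def)
    define g where "g s = f Z s / f Z n + t * basis z s" for s
    define Z' where "Z' = insert s0 (Z - {z})"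
    have Z'n: "Z' \<subseteq> {..<n}" using Zn N_free[OF s0] by (auto simp: Z'_def)
    have g_nonneg: "g s \<ge> 0" if "s \<le> n" for s
    proof (cases "s \<in> N")
      case True
      then have "t \<le> \<tau> s" using s0_min by (simp add: t_def)
      moreover have neg_s: "basis z s < 0" using True by (simp add: N_def)
      ultimately have "t * (- basis z s) \<le> f Z s / f Z n"
        unfolding \<tau>_def by (subst (asm) pos_le_divide_eq) auto
      then show ?thesis by (simp add: g_def)
    next
      case False
      then have "basis z s \<ge> 0" using that by (simp add: N_def)
      then show ?thesis using t_pos fZ[OF that] f_n[OF Zn] by (simp add: g_def)
    qed
    have g_s0: "g s0 = 0" using s0 by (simp add: g_def t_def \<tau>_def N_def)
    have g_n: "g n = 1" using f_n[OF Zn] node[of n] z n_notin by (auto simp: g_def)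
    define h where "h s = (\<Prod>y\<in>Z - {z}. real s - real y)" for s
    define D where "D = (\<Prod>y\<in>insert n Z - {z}. real z - real y)"
    have f_h: "f Z s = (real s - real z) * h s" for s
      unfolding f_def h_def using fin z by (simp add: prod.remove)
    have lb_h: "basis z s = (real s - real n) * h s / D" for s
    proof -
      have "insert n Z - {z} = insert n (Z - {z})" using n_notin z by auto
      then show ?thesis
        using fin n_notin by (simp add: basis_def lagrange_basis_def prod_dividef D_def h_def)
    qed
    have f_h': "f Z' s = (real s - real s0) * h s" for s
      unfolding f_def h_def Z'_def using fin N_free[OF s0] by (simp add: prod.insert)
    \<comment> \<open>After division by the common factor \<open>h\<close>, \<open>g\<close> is linear with zero \<open>s0\<close>, hence proportional to the polynomial of \<open>Z'\<close>.\<close>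
    define a where "a = 1 / f Z n + t / D"
    define b where "b = - real z / f Z n - t * real n / D"
    have g_ab: "g s = (a * real s + b) * h s" for s
      by (simp add: g_def f_h[of s] lb_h a_def b_def add_divide_distrib diff_divide_distrib algebra_simps)
    have "h s0 \<noteq> 0" using f_pos[OF s0] by (auto simp: f_h)
    then have "b = - a * real s0" using g_s0 by (simp add: g_ab)
    then have g_f: "g s = a * f Z' s" for s by (simp add: g_ab f_h' algebra_simps)
    then have a: "a = 1 / f Z' n" using g_n[unfolded g_f] f_n[OF Z'n] by (simp add: field_simps)
    have "a > 0" using f_n[OF Z'n] by (simp add: a)
    have "Z' \<in> \<Z>"
    proof -
      have "card Z' = Suc (card (Z - {z}))"
        unfolding Z'_def using N_free[OF s0] fin by (intro card_insert_disjoint) auto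
      also have "\<dots> = k" using card.remove[OF fin z] cZ by linarith
      finally have "card Z' = k" .
      moreover have "f Z' s \<ge> 0" if "s \<le> n" for s
        using g_nonneg[OF that] \<open>a > 0\<close> by (simp add: g_f zero_le_mult_iff)
      ultimately show ?thesis using Z'n by (simp add: \<Z>_def)
    qed
    then have "val Z \<le> val Z'" by (rule min)
    also have "val Z' = E g" by (simp add: val_def E_def g_f a)
    also have "E g = val Z + t * E (basis z)"
      by (simp add: E_def val_def g_def sum.distrib sum_distrib_left algebra_simps)
    also have "\<dots> < val Z" using t_pos neg by (simp add: mult_pos_neg)
    finally show False by simp
  qed
  show thesis
    by (rule that[of Z]) (use Zn cZ fZ nonneg_n nonneg_Z in \<open>auto simp: f_def E_def basis_def\<close>)
qed

section \<open>Zeros in adjacent pairs and their midpoints\<close>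

lemma sign_prod_differences:
  assumes "finite Z" "s \<notin> Z"
  shows "(-1) ^ card {z\<in>Z. s < z} * (\<Prod>z\<in>Z. real s - real z) > 0"
  using assms
proof (induction Z rule: finite_induct)
  case (insert x Z)
  have split: "{z \<in> insert x Z. s < z} = (if s < x then insert x {z\<in>Z. s < z} else {z\<in>Z. s < z})"
    by auto
  from insert have IH: "0 < (-1) ^ card {z\<in>Z. s < z} * (\<Prod>z\<in>Z. real s - real z)" by auto
  show ?case
  proof (cases "s < x")
    case True
    then have "(-1) ^ card {z\<in>insert x Z. s < z} * (\<Prod>z\<in>insert x Z. real s - real z)
      = (real x - real s) * ((-1) ^ card {z\<in>Z. s < z} * (\<Prod>z\<in>Z. real s - real z))"
      unfolding split using insert.hyps by (simp add: algebra_simps)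
    then show ?thesis using IH True by simp
  next
    case False
    then have "(-1) ^ card {z\<in>insert x Z. s < z} * (\<Prod>z\<in>insert x Z. real s - real z)
      = (real s - real x) * ((-1) ^ card {z\<in>Z. s < z} * (\<Prod>z\<in>Z. real s - real z))"
      unfolding split using insert.hyps by (simp add: algebra_simps)
    moreover have "x < s" using False insert.prems by simp
    ultimately show ?thesis using IH by simp
  qed
qed simp

text \<open>
  The sign of the polynomial at an integer outside \<open>Z\<close> is the parity of the number of zeros above,
  so this number is even at all integers outside \<open>Z\<close>. The lower member of a pair is then a
  zero with an odd number of zeros above it. That \<open>card Z\<close> is even serves to exclude the zero \<open>0\<close> as
  an unpaired upper member.
\<close>

lemma zeros_in_adjacent_pairs:
  assumes Zn: "Z \<subseteq> {..<n}" and even_Z: "even (card Z)"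
    and nonneg: "\<And>s. s \<le> n \<Longrightarrow> (\<Prod>z\<in>Z. real s - real z) \<ge> 0"
  obtains Y where "Z = Y \<union> Suc ` Y" "Y \<inter> Suc ` Y = {}"
proof -
  have fin: "finite Z" using Zn finite_subset by blast
  define a where "a s = card {z\<in>Z. s < z}" for s
  have even_a: "even (a s)" if "s \<le> n" "s \<notin> Z" for s
  proof (rule ccontr)
    assume "odd (a s)"
    then show False
      using sign_prod_differences[OF fin that(2)] nonneg[OF that(1)] by (simp add: a_def)
  qed
  have a_step: "a s = (if Suc s \<in> Z then Suc (a (Suc s)) else a (Suc s))" for s
  proof -
    have "s < x \<longleftrightarrow> x = Suc s \<or> Suc s < x" for x by linarith
    then have "{z\<in>Z. s < z} = (if Suc s \<in> Z then insert (Suc s) {z\<in>Z. Suc s < z} else {z\<in>Z. Suc s < z})"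
      by auto
    then show ?thesis using fin by (auto simp: a_def)
  qed
  define Y where "Y = {z\<in>Z. odd (a z)}"
  have up: "Suc y \<in> Z \<and> Suc y \<notin> Y" if "y \<in> Y" for y
  proof -
    have y: "y < n" "odd (a y)" using that Zn by (auto simp: Y_def)
    have "Suc y \<in> Z" using even_a[of "Suc y"] a_step[of y] y by (auto split: if_splits)
    then show ?thesis using a_step[of y] y by (simp add: Y_def)
  qed
  have down: "z \<in> Suc ` Y" if z: "z \<in> Z" "z \<notin> Y" for z
  proof (cases z)
    case 0
    have "Z = insert 0 {x\<in>Z. 0 < x}" using z 0 by auto
    moreover have "card (insert 0 {x\<in>Z. 0 < x}) = Suc (a 0)" using fin by (simp add: a_def)
    ultimately have "card Z = Suc (a 0)" by metis
    then show ?thesis using z even_Z 0 by (simp add: Y_def)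
  next
    case (Suc w)
    have "odd (a w)" using a_step[of w] z Suc by (simp add: Y_def)
    moreover have "w \<le> n" using z Zn Suc by auto
    ultimately have "w \<in> Z" using even_a by blast
    then show ?thesis using Suc \<open>odd (a w)\<close> by (simp add: Y_def)
  qed
  show thesis
    by (rule that[of Y]) (use up down in \<open>auto simp: Y_def\<close>)
qed

lemma sum_inverse_pronic_le_one:
  assumes "finite D" "\<And>d::nat. d \<in> D \<Longrightarrow> d \<ge> 1"
  shows "(\<Sum>d\<in>D. 1 / (real d * (real d + 1))) \<le> 1"
proof -
  define m where "m = Max (insert 0 D)"
  have "(\<Sum>d\<in>D. 1 / (real d * (real d + 1))) \<le> (\<Sum>d\<in>{1..m}. 1 / (real d * (real d + 1)))"
    using assms by (intro sum_mono2) (auto simp: m_def)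
  also have "\<dots> = 1 - 1 / (real m + 1)"
  proof (induction m)
    case (Suc m)
    have "1 / (real (Suc m) * (real (Suc m) + 1)) = 1 / (real m + 1) - 1 / (real (Suc m) + 1)"
      by (simp add: divide_simps)
    with Suc show ?case by (simp add: add.commute)
  qed simp
  also have "\<dots> \<le> 1" by simp
  finally show ?thesis .
qed

text \<open>
  With \<open>a = (s - y) * (s - y - 1)\<close> the square of \<open>s - y - 1/2\<close> is \<open>a + 1/4 \<le> a * exp (1 / (4 * a))\<close>,
  and \<open>a = d * (d + 1)\<close> where \<open>d\<close> is the distance from \<open>s\<close> to the nearer point of the pair. On each
  side of \<open>s\<close> these distances are distinct, so the exponents on one side sum to at most \<open>1/4\<close>.
\<close>

lemma midpoint_square_le:
  fixes Y :: "nat set"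
  assumes fin: "finite Y" and s: "s \<notin> Y" "s \<notin> Suc ` Y"
  shows "(\<Prod>y\<in>Y. (real s - real y - 1/2)\<^sup>2)
           \<le> exp (1/2) * (\<Prod>y\<in>Y. (real s - real y) * (real s - real y - 1))"
proof -
  define a where "a y = (real s - real y) * (real s - real y - 1)" for y
  have a_left: "a y = real (s - y - 1) * (real (s - y - 1) + 1)" "s - y - 1 \<ge> 1"
    if "y \<in> Y" "y < s" for y
  proof -
    have "Suc y \<noteq> s" using that s by auto
    then have "Suc (Suc y) \<le> s" using that by linarith
    then show "a y = real (s - y - 1) * (real (s - y - 1) + 1)" "s - y - 1 \<ge> 1"
      by (auto simp: a_def of_nat_diff algebra_simps)
  qed
  have a_right: "a y = real (y - s) * (real (y - s) + 1)" if "s < y" for y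
    using that by (simp add: a_def of_nat_diff algebra_simps)
  have a_pos: "a y > 0" if "y \<in> Y" for y
  proof (cases "y < s")
    case True
    have "real (s - y - 1) > 0" using a_left(2)[OF that True] by simp
    then show ?thesis unfolding a_left(1)[OF that True] by (intro mult_pos_pos) auto
  next
    case False
    then have "s < y" using that s by (cases "s = y") auto
    then show ?thesis unfolding a_right[OF \<open>s < y\<close>] by (intro mult_pos_pos) auto
  qed
  have left: "(\<Sum>y\<in>{y\<in>Y. y < s}. 1 / a y) \<le> 1"
  proof -
    have "(\<Sum>y\<in>{y\<in>Y. y < s}. 1 / a y)
        = (\<Sum>d\<in>(\<lambda>y. s - y - 1) ` {y\<in>Y. y < s}. 1 / (real d * (real d + 1)))"
      by (subst sum.reindex) (auto simp: inj_on_def a_left(1))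
    also have "\<dots> \<le> 1"
      using a_left(2) fin by (intro sum_inverse_pronic_le_one) auto
    finally show ?thesis .
  qed
  have right: "(\<Sum>y\<in>{y\<in>Y. s < y}. 1 / a y) \<le> 1"
  proof -
    have "(\<Sum>y\<in>{y\<in>Y. s < y}. 1 / a y)
        = (\<Sum>d\<in>(\<lambda>y. y - s) ` {y\<in>Y. s < y}. 1 / (real d * (real d + 1)))"
      by (subst sum.reindex) (auto simp: inj_on_def a_right)
    also have "\<dots> \<le> 1"
      using fin by (intro sum_inverse_pronic_le_one) auto
    finally show ?thesis .
  qed
  have "{y\<in>Y. y < s} \<union> {y\<in>Y. s < y} = Y" using s(1) by (auto simp: not_less_iff_gr_or_eq)
  moreover have "(\<Sum>y\<in>{y\<in>Y. y < s} \<union> {y\<in>Y. s < y}. 1 / a y)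
      = (\<Sum>y\<in>{y\<in>Y. y < s}. 1 / a y) + (\<Sum>y\<in>{y\<in>Y. s < y}. 1 / a y)"
    using fin by (intro sum.union_disjoint) auto
  ultimately have "(\<Sum>y\<in>Y. 1 / a y) \<le> 2" using left right by simp
  moreover have "(\<Sum>y\<in>Y. 1 / (4 * a y)) = (\<Sum>y\<in>Y. 1 / a y) / 4"
    by (simp add: sum_divide_distrib mult.commute)
  ultimately have sum_le: "(\<Sum>y\<in>Y. 1 / (4 * a y)) \<le> 1/2" by simp
  have "(\<Prod>y\<in>Y. (real s - real y - 1/2)\<^sup>2) \<le> (\<Prod>y\<in>Y. exp (1 / (4 * a y)) * a y)"
  proof (intro prod_mono conjI)
    fix y assume "y \<in> Y"
    then have pos: "a y > 0" by (rule a_pos)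
    have "(real s - real y - 1/2)\<^sup>2 = a y + 1/4"
      by (simp add: a_def power2_eq_square algebra_simps)
    also have "\<dots> = (1 + 1 / (4 * a y)) * a y" using pos by (simp add: field_simps)
    also have "\<dots> \<le> exp (1 / (4 * a y)) * a y"
      using pos by (intro mult_right_mono exp_ge_add_one_self) auto
    finally show "(real s - real y - 1/2)\<^sup>2 \<le> exp (1 / (4 * a y)) * a y" .
  qed simp
  also have "\<dots> = exp (\<Sum>y\<in>Y. 1 / (4 * a y)) * (\<Prod>y\<in>Y. a y)"
    using fin by (simp add: prod.distrib exp_sum)
  also have "\<dots> \<le> exp (1/2) * (\<Prod>y\<in>Y. a y)"
    using sum_le a_pos by (intro mult_right_mono prod_nonneg) (auto intro: less_imp_le)
  finally show ?thesis by (simp add: a_def)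
qed

section \<open>Weights in the gaps of a set of integers\<close>

text \<open>
  For \<open>F = {0..n}\<close> and \<open>r = p / (1 - p)\<close> these are the binomial weights up to a constant; for
  other \<open>F\<close> they are what remains of them after multiplication by the distances to the points of
  \<open>{0..n} - F\<close>.
\<close>

definition weight :: "real \<Rightarrow> nat set \<Rightarrow> nat \<Rightarrow> real" where
  "weight r F x = r ^ x / (\<Prod>j\<in>F - {x}. \<bar>real x - real j\<bar>)"

lemma weight_pos: "r > 0 \<Longrightarrow> weight r F x > 0"
  unfolding weight_def by (cases "finite F") (auto intro!: divide_pos_pos prod_pos)

text \<open>
  Outside the factors of the ends \<open>A\<close> and \<open>B\<close>, the logarithm of the weight is \<open>x * ln r\<close> minus a sum of
  functions \<open>ln \<bar>x - j\<bar>\<close>, which are concave between \<open>A\<close> and \<open>B\<close>. So this part is convex there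
  and at most its larger end value. The ends contribute \<open>1 / ((z - A) * (B - z))\<close> at \<open>z\<close>, which is
  at most \<open>2 / (B - A)\<close>, and \<open>1 / (B - A)\<close> at \<open>A\<close> and at \<open>B\<close>.
\<close>

lemma weight_in_gap_le:
  assumes fin: "finite F" and A: "A \<in> F" "A < z" and B: "B \<in> F" "z < B"
    and gap: "\<And>j. j \<in> F \<Longrightarrow> j \<le> A \<or> B \<le> j" and r: "r > 0"
  shows "weight r F z \<le> 2 * max (weight r F A) (weight r F B)"
proof -
  define G where "G = F - {A, B}"
  define h where "h x = real x * ln r - (\<Sum>j\<in>G. ln \<bar>real x - real j\<bar>)" for x
  define t where "t = (real B - real z) / (real B - real A)"
  have t: "0 \<le> t" "t \<le> 1" using A B by (auto simp: t_def divide_simps)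
  have z: "real z = t * real A + (1 - t) * real B"
  proof -
    have "t * (real B - real A) = real B - real z" using A B by (simp add: t_def)
    then show ?thesis by (simp add: algebra_simps)
  qed
  have out: "j < A \<or> B < j" if "j \<in> G" for j
    using gap[of j] that by (auto simp: G_def)
  have ln_concave': "t * ln x + (1 - t) * ln y \<le> ln (t * x + (1 - t) * y)" if "x > 0" "y > 0" for x y :: real
    using concave_onD[OF ln_concave, of "1 - t" x y] t that by simp
  have "t * h A + (1 - t) * h B - h z
     = (\<Sum>j\<in>G. ln \<bar>real z - real j\<bar> - (t * ln \<bar>real A - real j\<bar> + (1 - t) * ln \<bar>real B - real j\<bar>))"
    unfolding h_def z by (simp add: sum_subtractf sum.distrib sum_distrib_left algebra_simps)
  also have "\<dots> \<ge> 0"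
  proof (intro sum_nonneg)
    fix j assume "j \<in> G"
    have "\<bar>real z - real j\<bar> = t * \<bar>real A - real j\<bar> + (1 - t) * \<bar>real B - real j\<bar>"
      using out[OF \<open>j \<in> G\<close>] A B z by (auto simp: abs_if algebra_simps)
    then show "0 \<le> ln \<bar>real z - real j\<bar> - (t * ln \<bar>real A - real j\<bar> + (1 - t) * ln \<bar>real B - real j\<bar>)"
      using ln_concave'[of "\<bar>real A - real j\<bar>" "\<bar>real B - real j\<bar>"] out[OF \<open>j \<in> G\<close>] A B by auto
  qed
  finally have "h z \<le> t * h A + (1 - t) * h B" by simp
  also have "\<dots> \<le> max (h A) (h B)" using t by (intro convex_bound_le) auto
  finally have h_le: "exp (h z) \<le> max (exp (h A)) (exp (h B))" by (auto simp: le_max_iff_disj)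
  have exp_h: "exp (h x) = r ^ x / (\<Prod>j\<in>G. \<bar>real x - real j\<bar>)" if "A \<le> x" "x \<le> B" for x
  proof -
    have "real x - real j \<noteq> 0" if "j \<in> G" for j
      using out[OF that] \<open>A \<le> x\<close> \<open>x \<le> B\<close> by auto
    then have "exp (\<Sum>j\<in>G. ln \<bar>real x - real j\<bar>) = (\<Prod>j\<in>G. \<bar>real x - real j\<bar>)"
      using fin by (auto simp: exp_sum G_def intro!: prod.cong)
    moreover have "exp (real x * ln r) = r ^ x" using r by (simp add: exp_of_nat_mult)
    ultimately show ?thesis by (simp add: h_def exp_diff)
  qed
  have finG: "finite G" using fin by (simp add: G_def)
  have z_notin: "z \<notin> F" using gap[of z] A B by auto
  have F_z: "F - {z} = insert A (insert B G)" "F - {A} = insert B G" "F - {B} = insert A G"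
    using A B z_notin by (auto simp: G_def)
  have notin: "A \<notin> insert B G" "B \<notin> G" "A \<notin> G" using A B by (auto simp: G_def)
  have w_z: "weight r F z = exp (h z) / ((real z - real A) * (real B - real z))"
    using A B notin finG by (simp add: weight_def F_z exp_h abs_if)
  have w_A: "weight r F A = exp (h A) / (real B - real A)"
    using A B notin finG by (simp add: weight_def F_z exp_h abs_if)
  have w_B: "weight r F B = exp (h B) / (real B - real A)"
    using A B notin finG by (simp add: weight_def F_z exp_h abs_if)
  define u v where "u = real z - real A" and "v = real B - real z"
  have uv: "u \<ge> 1" "v \<ge> 1" using A B by (auto simp: u_def v_def)
  have "0 \<le> (u - 1) * (v - 1)" using uv by simp
  moreover have "0 \<le> u * v" using uv by simp
  ultimately have "u + v \<le> 2 * (u * v)" using mult_mono[of 1 u 1 v] uv by (simp add: algebra_simps)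
  then have "1 / (u * v) \<le> 2 / (u + v)" using uv by (simp add: field_simps)
  from mult_left_mono[OF this, of "exp (h z)"]
  have "exp (h z) / (u * v) \<le> exp (h z) * 2 / (u + v)" by simp
  also have "\<dots> \<le> max (exp (h A)) (exp (h B)) * 2 / (u + v)"
    using uv h_le by (intro divide_right_mono mult_right_mono) auto
  also have "u + v = real B - real A" by (simp add: u_def v_def)
  also have "max (exp (h A)) (exp (h B)) * 2 / (real B - real A)
     = 2 * max (weight r F A) (weight r F B)"
    using A B by (auto simp: w_A w_B max_def divide_simps)
  finally show ?thesis by (simp add: w_z u_def v_def)
qed

lemma prod_shift_ratio_le:
  fixes U :: "nat set"
  assumes "finite U" "\<And>u. u \<in> U \<Longrightarrow> u \<ge> 1"
  shows "(\<Prod>u\<in>U. real (u + d) / real u) \<le> (\<Prod>u\<in>{1..card U}. real (u + d) / real u)"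
  using assms
proof (induction U rule: finite_linorder_max_induct)
  case (insert b U)
  have "insert b U \<subseteq> {1..b}" using insert by force
  then have "card (insert b U) \<le> card {1..b}" by (rule card_mono[rotated]) simp
  then have "Suc (card U) \<le> b" using insert by (auto simp: card_insert_if)
  then have "real d / real b \<le> real d / real (Suc (card U))"
    by (intro divide_left_mono) (simp_all del: of_nat_Suc)
  moreover have "real (x + d) / real x = 1 + real d / real x" if "x > 0" for x
    using that by (simp add: add_divide_distrib)
  ultimately have "real (b + d) / real b \<le> real (Suc (card U) + d) / real (Suc (card U))"
    using \<open>Suc (card U) \<le> b\<close> by (simp del: of_nat_Suc of_nat_add add_Suc)
  moreover have "(\<Prod>u\<in>U. real (u + d) / real u) \<le> (\<Prod>u\<in>{1..card U}. real (u + d) / real u)"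
    using insert by auto
  ultimately have "real (b + d) / real b * (\<Prod>u\<in>U. real (u + d) / real u)
     \<le> real (Suc (card U) + d) / real (Suc (card U)) * (\<Prod>u\<in>{1..card U}. real (u + d) / real u)"
    by (intro mult_mono prod_nonneg) auto
  moreover have "b \<notin> U" using insert by auto
  ultimately show ?case using insert.hyps(1) by (simp add: mult.commute add.assoc)
qed simp

lemma prod_shift_ratio_eq_fact:
  "(\<Prod>u\<in>{1..m}. real (u + d) / real u) = fact (m + d) / (fact m * fact d)"
proof (induction m)
  case (Suc m)
  then have "(\<Prod>u\<in>{1..Suc m}. real (u + d) / real u)
      = fact (m + d) / (fact m * fact d) * (real (Suc m + d) / real (Suc m))"
    by simp
  also have "\<dots> = fact (Suc m + d) / (fact (Suc m) * fact d)"
    by (simp add: divide_simps)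
  finally show ?case .
qed simp

text \<open>
  With \<open>d = B - z\<close>, the quotient of the two weights is governed by \<open>r ^ d\<close> times the product of
  \<open>(u + d) / u\<close> over the distances \<open>u\<close> from \<open>B\<close> to the other points of \<open>F\<close>. The \<open>k - B\<close>
  distances in \<open>{1..n - B}\<close> that are missing take away the most if they are the smallest ones, and then
  the product telescopes to \<open>(\<Prod>e=1..d. (n - B + e) / (k - B + e)) \<ge> (n / k) ^ d\<close>. So the
  hypothesis \<open>k \<le> n * r\<close> makes the weight at \<open>B\<close> the larger one.
\<close>

lemma weight_below_minimum_le:
  assumes F: "F \<subseteq> {..n}" "card F = n + 1 - k" and k: "1 \<le> k" "k \<le> n"
    and B: "B \<in> F" "\<And>j. j \<in> F \<Longrightarrow> B \<le> j" and z: "z < B"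
    and r: "r > 0" "real k \<le> real n * r"
  shows "weight r F z \<le> weight r F B"
proof -
  define d where "d = B - z"
  define U where "U = (\<lambda>j. j - B) ` (F - {B})"
  define W where "W = {1..n - B} - U"
  have fin: "finite F" using F finite_subset by blast
  have inj: "inj_on (\<lambda>j. j - B) (F - {B})"
    using B(2) by (intro inj_onI) (metis DiffD1 eq_diff_iff)
  have U: "U \<subseteq> {1..n - B}"
    using B F by (fastforce simp: U_def Suc_le_eq dest: le_neq_implies_less)
  have finU: "finite U" using fin by (simp add: U_def)
  have "card U = n - k"
    using B fin F by (simp add: U_def card_image[OF inj])
  have "F \<subseteq> {B..n}" using F B by auto
  then have "card F \<le> card {B..n}" by (intro card_mono) auto
  then have "B \<le> k" using F k B by auto
  have card_W: "card W = k - B"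
    using U finU \<open>card U = n - k\<close> \<open>B \<le> k\<close> k by (simp add: W_def card_Diff_subset)
  have fin_W: "finite W" by (simp add: W_def)
  define R where "R u = real (u + d) / real u" for u
  have R_pos: "R u > 0" if "u \<ge> 1" for u using that by (simp add: R_def)
  have "(\<Prod>u\<in>W. R u) \<le> (\<Prod>u\<in>{1..card W}. R u)"
    unfolding R_def by (rule prod_shift_ratio_le[OF fin_W]) (simp add: W_def)
  also have "\<dots> = (\<Prod>e\<in>{1..d}. real (e + (k - B)) / real e)"
    unfolding R_def prod_shift_ratio_eq_fact card_W by (simp add: ac_simps)
  finally have R_W: "(\<Prod>u\<in>W. R u) \<le> (\<Prod>e\<in>{1..d}. real (e + (k - B)) / real e)" .
  have U_W: "{1..n - B} = U \<union> W" "U \<inter> W = {}" using U by (auto simp: W_def)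
  have "(\<Prod>u\<in>U. R u) * (\<Prod>u\<in>W. R u) = (\<Prod>u\<in>{1..n - B}. R u)"
    using U_W finU fin_W by (simp add: prod.union_disjoint)
  also have "\<dots> = (\<Prod>e\<in>{1..d}. real (e + (n - B)) / real e)"
    unfolding R_def prod_shift_ratio_eq_fact by (simp add: ac_simps)
  finally have R_UW: "(\<Prod>u\<in>U. R u) * (\<Prod>u\<in>W. R u) = (\<Prod>e\<in>{1..d}. real (e + (n - B)) / real e)" .
  have "(\<Prod>e\<in>{1..d}. real (e + (k - B)) / real e) \<le> (\<Prod>e\<in>{1..d}. r * (real (e + (n - B)) / real e))"
  proof (intro prod_mono conjI)
    fix e assume e: "e \<in> {1..d}"
    define x where "x = real B - real e"
    have x: "x \<ge> 0" using e by (auto simp: x_def d_def)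
    have eqs: "real (e + (k - B)) = real k - x" "real (e + (n - B)) = real n - x"
      using \<open>B \<le> k\<close> k by (auto simp: x_def of_nat_diff)
    have "real k * (real n - x) - real n * (real k - x) = x * (real n - real k)"
      by (simp add: algebra_simps)
    then have "real n * (real k - x) \<le> real k * (real n - x)"
      using x k by (metis diff_ge_0_iff_ge mult_nonneg_nonneg of_nat_le_iff)
    also have "\<dots> \<le> real n * r * (real n - x)"
      using r(2) eqs(2) by (intro mult_right_mono) (auto simp del: of_nat_add simp flip: eqs(2))
    finally have "real k - x \<le> r * (real n - x)" using k by (simp add: mult.assoc)
    then show "real (e + (k - B)) / real e \<le> r * (real (e + (n - B)) / real e)"
      unfolding eqs using e by (simp add: divide_right_mono)
  qed simp
  also have "\<dots> = r ^ d * ((\<Prod>u\<in>U. R u) * (\<Prod>u\<in>W. R u))"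
    unfolding R_UW prod.distrib by simp
  finally have "(\<Prod>u\<in>W. R u) * 1 \<le> (\<Prod>u\<in>W. R u) * (r ^ d * (\<Prod>u\<in>U. R u))"
    using R_W by (simp add: ac_simps)
  moreover have "(\<Prod>u\<in>W. R u) > 0" by (intro prod_pos R_pos) (auto simp: W_def)
  ultimately have one_le: "1 \<le> r ^ d * (\<Prod>u\<in>U. R u)" by simp
  have d: "d \<ge> 1" using z by (simp add: d_def)
  have "z \<notin> F" using B(2)[of z] z by auto
  then have F_z: "F - {z} = insert B (F - {B})" using B by auto
  have w_z: "weight r F z = r ^ z / (real d * (\<Prod>u\<in>U. real (u + d)))"
  proof -
    have "(\<Prod>u\<in>U. real (u + d)) = (\<Prod>j\<in>F - {B}. \<bar>real z - real j\<bar>)"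
      unfolding U_def using B z
      by (subst prod.reindex[OF inj], intro prod.cong refl) (force simp: d_def of_nat_diff)
    moreover have "(\<Prod>j\<in>F - {z}. \<bar>real z - real j\<bar>) = real d * (\<Prod>j\<in>F - {B}. \<bar>real z - real j\<bar>)"
      unfolding F_z using fin z by (subst prod.insert) (auto simp: d_def of_nat_diff)
    ultimately show ?thesis by (simp add: weight_def)
  qed
  have w_B: "weight r F B = r ^ B / (\<Prod>u\<in>U. real u)"
  proof -
    have "(\<Prod>u\<in>U. real u) = (\<Prod>j\<in>F - {B}. \<bar>real B - real j\<bar>)"
      unfolding U_def using B
      by (subst prod.reindex[OF inj], intro prod.cong refl) (force simp: of_nat_diff)
    then show ?thesis by (simp add: weight_def)
  qed
  have pos: "(\<Prod>u\<in>U. real (u + d)) > 0" "(\<Prod>u\<in>U. real u) > 0"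
    using U by (auto intro!: prod_pos)
  have "weight r F z \<le> r ^ z / (\<Prod>u\<in>U. real (u + d))"
    unfolding w_z using pos d r by (intro divide_left_mono mult_pos_pos) auto
  also have "\<dots> * 1 \<le> r ^ z / (\<Prod>u\<in>U. real (u + d)) * (r ^ d * (\<Prod>u\<in>U. R u))"
    using one_le pos r by (intro mult_left_mono) auto
  also have "\<dots> = r ^ (z + d) / (\<Prod>u\<in>U. real u)"
    using pos by (simp add: R_def prod_dividef power_add)
  also have "\<dots> = weight r F B" using z by (simp add: w_B d_def)
  finally show ?thesis by simp
qed

lemma sum_weight_gaps_le:
  assumes Z: "Z \<subseteq> {..<n}" "card Z = k" and k: "1 \<le> k"
    and r: "r > 0" "real k \<le> real n * r"
  defines "F \<equiv> {..n} - Z"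
  shows "(\<Sum>z\<in>Z. weight r F z) \<le> 2 * real k * (\<Sum>s\<in>F. weight r F s)"
proof -
  define S where "S = (\<Sum>s\<in>F. weight r F s)"
  have fin: "finite F" "finite Z" using Z finite_subset by (auto simp: F_def)
  have "n \<in> F" using Z by (auto simp: F_def)
  have kn: "k \<le> n" using card_mono[OF _ Z(1)] Z(2) by simp
  have "card F = n + 1 - k" using Z fin by (subst F_def, subst card_Diff_subset) auto
  have S_ge: "weight r F s \<le> S" if "s \<in> F" for s
    unfolding S_def using that fin r by (intro member_le_sum) (auto intro: less_imp_le weight_pos)
  have bound: "weight r F z \<le> 2 * S" if z: "z \<in> Z" for z
  proof -
    define B where "B = Min {j\<in>F. z < j}"
    have "{j\<in>F. z < j} \<noteq> {}" using \<open>n \<in> F\<close> z Z by auto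
    then have "B \<in> {j\<in>F. z < j}" unfolding B_def using fin by (intro Min_in) auto
    then have B: "B \<in> F" "z < B" by auto
    have B_min: "B \<le> j" if "j \<in> F" "z < j" for j
      unfolding B_def using that fin by (intro Min_le) auto
    have "z \<notin> F" using z by (simp add: F_def)
    show ?thesis
    proof (cases "{j\<in>F. j < z} = {}")
      case True
      then have "B \<le> j" if "j \<in> F" for j
        using B_min[OF that] that \<open>z \<notin> F\<close> by (metis (mono_tags, lifting) empty_Collect_eq linorder_neqE_nat)
      then have "weight r F z \<le> weight r F B"
        using B \<open>card F = n + 1 - k\<close> k kn r
        by (intro weight_below_minimum_le[where n = n and k = k]) (auto simp: F_def)
      also have "\<dots> \<le> 2 * S"
        using S_ge[OF B(1)] weight_pos[OF r(1), of F B] by linarith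
      finally show ?thesis .
    next
      case False
      define A where "A = Max {j\<in>F. j < z}"
      have "A \<in> {j\<in>F. j < z}" unfolding A_def using fin False by (intro Max_in) auto
      then have A: "A \<in> F" "A < z" by auto
      have A_max: "j \<le> A" if "j \<in> F" "j < z" for j
        unfolding A_def using that fin by (intro Max_ge) auto
      have "j \<le> A \<or> B \<le> j" if "j \<in> F" for j
        using A_max[OF that] B_min[OF that] that \<open>z \<notin> F\<close> by (cases j z rule: linorder_cases) auto
      then have "weight r F z \<le> 2 * max (weight r F A) (weight r F B)"
        using A B fin r by (intro weight_in_gap_le) auto
      then show ?thesis using S_ge[OF A(1)] S_ge[OF B(1)] by linarith
    qed
  qed
  have "(\<Sum>z\<in>Z. weight r F z) \<le> (\<Sum>z\<in>Z. 2 * S)" by (intro sum_mono bound)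
  then show ?thesis using Z by (simp add: S_def)
qed

section \<open>Bounds for the two maxima\<close>

lemma expectation_binomial:
  assumes "0 \<le> p" "p \<le> 1"
  shows "measure_pmf.expectation (binomial_pmf n p) g
    = (\<Sum>s\<le>n. (real (n choose s) * p ^ s * (1 - p) ^ (n - s)) * g s)"
proof -
  have "measure_pmf.expectation (binomial_pmf n p) g = (\<Sum>s\<le>n. g s * pmf (binomial_pmf n p) s)"
    using assms by (intro integral_measure_pmf_real) (auto simp: set_pmf_binomial_eq split: if_splits)
  then show ?thesis using assms by (simp add: mult.commute)
qed

text \<open>
  The square of \<open>q\<close> has degree at most \<open>k\<close>, so all laws in question give it the same expectation as the
  binomial law, and it is at least \<open>(q n)\<^sup>2\<close> times the indicator of \<open>n\<close>.
\<close>

lemma max_top_mass_le: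
  fixes q :: "real poly"
  assumes p: "0 < p" "p < 1" and deg: "2 * degree q \<le> k" and q_n: "poly q (real n) \<noteq> 0"
  shows "max_top_mass n k p
    \<le> measure_pmf.expectation (binomial_pmf n p) (\<lambda>s. (poly q (real s))\<^sup>2) / (poly q (real n))\<^sup>2"
  unfolding max_top_mass_def
proof (rule cSUP_least)
  show "moment_laws n k p \<noteq> {}" using p by (rule moment_laws_nonempty)
next
  fix D assume D: "D \<in> moment_laws n k p"
  then interpret real_distribution D by (simp add: moment_laws_def)
  have supp: "AE s in D. s \<in> {0..real n}"
    and moments: "\<And>i. i \<in> {1..k} \<Longrightarrow> (LINT s|D. s ^ i) =
            measure_pmf.expectation (binomial_pmf n p) (\<lambda>x. real x ^ i)"
    using D by (auto simp: moment_laws_def)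
  have int: "integrable D (\<lambda>s. s ^ i)" for i
  proof (rule integrable_const_bound)
    show "AE s in D. norm (s ^ i) \<le> real n ^ i"
      using supp by eventually_elim (auto simp: power_abs intro!: power_mono)
  qed simp
  define P where "P = q ^ 2"
  have "degree P \<le> 2 * degree q" unfolding P_def by (metis degree_power_le mult.commute)
  with deg have deg_P: "degree P \<le> k" by simp
  have moment: "(LINT s|D. s ^ i) = measure_pmf.expectation (binomial_pmf n p) (\<lambda>x. real x ^ i)"
    if "i \<le> degree P" for i
    using moments[of i] that deg_P prob_space by (cases "i = 0") auto
  have int_B: "integrable (binomial_pmf n p) (g :: nat \<Rightarrow> real)" for g
    using p by (intro integrable_measure_pmf_finite) (simp add: set_pmf_binomial)
  have "(LINT s|D. poly P s) = (\<Sum>i\<le>degree P. coeff P i * (LINT s|D. s ^ i))"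
    unfolding poly_altdef using int by simp
  also have "\<dots> = (\<Sum>i\<le>degree P. coeff P i * measure_pmf.expectation (binomial_pmf n p) (\<lambda>x. real x ^ i))"
    by (intro sum.cong) (auto simp: moment)
  also have "\<dots> = measure_pmf.expectation (binomial_pmf n p) (\<lambda>s. poly P (real s))"
    unfolding poly_altdef using int_B by simp
  finally have eq: "(LINT s|D. poly P s) = measure_pmf.expectation (binomial_pmf n p) (\<lambda>s. poly P (real s))" .
  have "measure D {real n} * poly P (real n) = (LINT s|D. indicator {real n} s * poly P (real n))"
    by simp
  also have "\<dots> \<le> (LINT s|D. poly P s)"
  proof (rule integral_mono)
    show "integrable D (\<lambda>s. indicator {real n} s * poly P (real n))"
      by (intro integrable_mult_left integrable_real_indicator) (auto simp: emeasure_eq_measure)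
    show "integrable D (poly P)"
      unfolding poly_altdef using int by simp
  qed (auto simp: P_def indicator_def)
  finally have "measure D {real n} * (poly q (real n))\<^sup>2
      \<le> measure_pmf.expectation (binomial_pmf n p) (\<lambda>s. (poly q (real s))\<^sup>2)"
    unfolding eq by (simp add: P_def)
  then show "measure D {real n}
      \<le> measure_pmf.expectation (binomial_pmf n p) (\<lambda>s. (poly q (real s))\<^sup>2) / (poly q (real n))\<^sup>2"
    using q_n by (simp add: pos_le_divide_eq)
qed

text \<open>
  For the exchangeable law on subsets of \<open>{1..n}\<close> whose cardinality has law \<open>h\<close>, this expresses
  the probability of containing \<open>S\<close> as a normalised factorial moment of \<open>h\<close>.
\<close>

lemma sum_over_supersets:
  fixes h :: "nat \<Rightarrow> real"
  assumes S: "S \<subseteq> {1..n::nat}"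
  shows "(\<Sum>A\<in>{A. S \<subseteq> A \<and> A \<subseteq> {1..n}}. h (card A) / real (n choose card A))
    = (\<Sum>s\<le>n. h s * real (s choose card S)) / real (n choose card S)"
proof -
  define j where "j = card S"
  have finS: "finite S" using S finite_subset by blast
  have j: "j \<le> n" using card_mono[OF _ S] by (simp add: j_def)
  have card_compl: "card ({1..n} - S) = n - j" using S finS by (simp add: j_def card_Diff_subset)
  have bij: "bij_betw ((\<union>) S) (Pow ({1..n} - S)) {A. S \<subseteq> A \<and> A \<subseteq> {1..n}}"
    by (rule bij_betwI[where g = "\<lambda>A. A - S"]) (use S in auto)
  have card_Un: "card (S \<union> B) = j + card B" if "B \<in> Pow ({1..n} - S)" for B
    unfolding j_def using that finS by (intro card_Un_disjoint) (auto intro: finite_subset)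
  have "(\<Sum>A\<in>{A. S \<subseteq> A \<and> A \<subseteq> {1..n}}. h (card A) / real (n choose card A))
     = (\<Sum>B\<in>Pow ({1..n} - S). h (j + card B) / real (n choose (j + card B)))"
    by (subst sum.reindex_bij_betw[OF bij, symmetric], intro sum.cong) (auto simp: card_Un)
  also have "\<dots> = (\<Sum>i\<le>n - j. \<Sum>B\<in>{B\<in>Pow ({1..n} - S). card B = i}. h (j + card B) / real (n choose (j + card B)))"
  proof (rule sum.group[symmetric])
    show "card ` Pow ({1..n} - S) \<subseteq> {..n - j}"
      using card_mono[of "{1..n} - S"] card_compl by fastforce
  qed auto
  also have "\<dots> = (\<Sum>i\<le>n - j. real ((n - j) choose i) * (h (j + i) / real (n choose (j + i))))"
  proof (intro sum.cong refl)
    fix i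
    have "card {B\<in>Pow ({1..n} - S). card B = i} = (n - j) choose i"
      using n_subsets[of "{1..n} - S" i] card_compl by (simp add: Pow_def)
    then show "(\<Sum>B\<in>{B\<in>Pow ({1..n} - S). card B = i}. h (j + card B) / real (n choose (j + card B)))
      = real ((n - j) choose i) * (h (j + i) / real (n choose (j + i)))" by simp
  qed
  also have "\<dots> = (\<Sum>i\<le>n - j. h (j + i) * real ((j + i) choose j) / real (n choose j))"
  proof (intro sum.cong refl)
    fix i assume i: "i \<in> {..n - j}"
    have "real (n choose (j + i)) * real ((j + i) choose j) = real (n choose j) * real ((n - j) choose i)"
      using choose_mult[of j "j + i" n] i j by (simp flip: of_nat_mult)
    moreover have pos: "real (n choose (j + i)) > 0" "real (n choose j) > 0" using i j by auto
    ultimately have eq: "real ((n - j) choose i)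
      = real (n choose (j + i)) * real ((j + i) choose j) / real (n choose j)"
      by (simp add: field_simps)
    show "real ((n - j) choose i) * (h (j + i) / real (n choose (j + i)))
      = h (j + i) * real ((j + i) choose j) / real (n choose j)"
      unfolding eq using pos by simp
  qed
  also have "\<dots> = (\<Sum>s\<in>{j..n}. h s * real (s choose j)) / real (n choose j)"
    unfolding sum_divide_distrib
    by (rule sum.reindex_bij_witness[of _ "\<lambda>s. s - j" "\<lambda>i. j + i"]) (use j in auto)
  also have "(\<Sum>s\<in>{j..n}. h s * real (s choose j)) = (\<Sum>s\<le>n. h s * real (s choose j))"
    by (rule sum.mono_neutral_left) auto
  finally show ?thesis by (simp add: j_def)
qed

text \<open>
  The witness spreads the mass \<open>w s\<close> evenly over the 0/1 vectors with \<open>s\<close> ones.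
\<close>

lemma max_all_ones_ge_factorial_moments:
  fixes w :: "nat \<Rightarrow> real"
  assumes w: "\<And>s. s \<le> n \<Longrightarrow> w s \<ge> 0"
    and moments: "\<And>j. j \<le> k \<Longrightarrow> j \<le> n \<Longrightarrow> (\<Sum>s\<le>n. w s * real (s choose j)) = real (n choose j) * p ^ j"
  shows "max_all_ones n k p \<ge> w n"
proof -
  define g where "g A = (if A \<subseteq> {1..n} then w (card A) / real (n choose card A) else 0)" for A :: "nat set"
  have card_le: "card A \<le> n" if "A \<subseteq> {1..n}" for A :: "nat set"
    using card_mono[OF _ that] by simp
  have g_nonneg: "g A \<ge> 0" for A
    using w card_le by (simp add: g_def)
  have sum_g: "(\<Sum>A\<in>{A. S \<subseteq> A \<and> A \<subseteq> {1..n}}. g A) = (\<Sum>s\<le>n. w s * real (s choose card S)) / real (n choose card S)"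
    if "S \<subseteq> {1..n}" for S
    unfolding sum_over_supersets[OF that, symmetric] by (intro sum.cong) (auto simp: g_def)
  have "(\<integral>\<^sup>+ A. ennreal (g A) \<partial>count_space UNIV) = (\<Sum>A\<in>Pow {1..n}. ennreal (g A))"
    by (rule nn_integral_count_space') (auto simp: g_def)
  also have "\<dots> = ennreal (\<Sum>A\<in>Pow {1..n}. g A)" by (rule sum_ennreal) (rule g_nonneg)
  also have "(\<Sum>A\<in>Pow {1..n}. g A) = 1"
    using sum_g[of "{}"] moments[of 0] by (simp add: Pow_def)
  finally have total: "(\<integral>\<^sup>+ A. ennreal (g A) \<partial>count_space UNIV) = 1" by simp
  define R where "R = embed_pmf g"
  have pmf_R: "pmf R A = g A" for A
    unfolding R_def by (rule pmf_embed_pmf[OF g_nonneg total])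
  have set_R: "set_pmf R \<subseteq> Pow {1..n}"
    by (auto simp: set_pmf_eq pmf_R g_def split: if_splits)
  define bits where "bits A = (\<lambda>i\<in>{1..n}. of_bool (i \<in> A) :: nat)" for A
  define Q where "Q = map_pmf bits R"
  have prob: "measure_pmf.prob Q {x. \<forall>i\<in>S. x i = 1}
     = (\<Sum>s\<le>n. w s * real (s choose card S)) / real (n choose card S)" if S: "S \<subseteq> {1..n}" for S
  proof -
    have "measure_pmf.prob Q {x. \<forall>i\<in>S. x i = 1} = measure_pmf.prob R {A. S \<subseteq> A}"
      using S unfolding Q_def measure_map_pmf
      by (intro arg_cong[where f = "measure_pmf.prob R"]) (force simp: bits_def)
    also have "\<dots> = measure_pmf.prob R {A. S \<subseteq> A \<and> A \<subseteq> {1..n}}"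
      using set_R by (intro measure_pmf.finite_measure_eq_AE) (auto simp: AE_measure_pmf_iff)
    also have "\<dots> = (\<Sum>A\<in>{A. S \<subseteq> A \<and> A \<subseteq> {1..n}}. g A)"
      by (subst measure_measure_pmf_finite) (auto simp: pmf_R intro: finite_subset[of _ "Pow {1..n}"])
    finally show ?thesis using sum_g[OF S] by simp
  qed
  have "Q \<in> kwise_laws n k p"
  proof -
    have "set_pmf Q \<subseteq> {1..n} \<rightarrow>\<^sub>E {0, 1}" by (auto simp: Q_def bits_def)
    moreover have "measure_pmf.prob Q {x. \<forall>i\<in>S. x i = 1} = p ^ card S"
      if "S \<subseteq> {1..n}" "card S \<le> k" for S
      using prob[OF that(1)] moments[OF that(2) card_le[OF that(1)]] card_le[OF that(1)] by simp
    ultimately show ?thesis by (simp add: kwise_laws_def)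
  qed
  moreover have "measure_pmf.prob Q {x. \<forall>i\<in>{1..n}. x i = 1} = w n"
  proof -
    have "(\<Sum>s\<le>n. w s * real (s choose n)) = (\<Sum>s\<in>{n}. w s * real (s choose n))"
      by (rule sum.mono_neutral_right) auto
    then show ?thesis using prob[of "{1..n}"] by simp
  qed
  ultimately show ?thesis
    unfolding max_all_ones_def by (metis (no_types, lifting) cSUP_upper bdd_above_kwise_laws)
qed

lemma binomial_factorial_moment:
  assumes j: "j \<le> n"
  shows "(\<Sum>s\<le>n. (real (n choose s) * p ^ s * (1 - p) ^ (n - s)) * real (s choose j)) = real (n choose j) * p ^ j"
proof -
  have "(\<Sum>s\<le>n. (real (n choose s) * p ^ s * (1 - p) ^ (n - s)) * real (s choose j))
     = (\<Sum>s\<in>{j..n}. (real (n choose s) * p ^ s * (1 - p) ^ (n - s)) * real (s choose j))"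
    by (rule sum.mono_neutral_right) auto
  also have "\<dots> = (\<Sum>i\<le>n - j. real (n choose j) * p ^ j * (real ((n - j) choose i) * p ^ i * (1 - p) ^ (n - j - i)))"
  proof (rule sum.reindex_bij_witness[of _ "\<lambda>i. j + i" "\<lambda>s. s - j"])
    fix s assume s: "s \<in> {j..n}"
    have choose: "real (n choose s) * real (s choose j) = real (n choose j) * real ((n - j) choose (s - j))"
      using choose_mult[of j s n] s by (simp flip: of_nat_mult)
    have power: "p ^ s = p ^ j * p ^ (s - j)" "n - j - (s - j) = n - s"
      using s by (auto simp flip: power_add)
    have "(real (n choose s) * p ^ s * (1 - p) ^ (n - s)) * real (s choose j)
      = (real (n choose s) * real (s choose j)) * p ^ s * (1 - p) ^ (n - s)" by simp
    also have "\<dots> = real (n choose j) * p ^ j * (real ((n - j) choose (s - j)) * p ^ (s - j) * (1 - p) ^ (n - j - (s - j)))"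
      unfolding choose power by simp
    finally show "real (n choose j) * p ^ j * (real ((n - j) choose (s - j)) * p ^ (s - j) * (1 - p) ^ (n - j - (s - j)))
      = (real (n choose s) * p ^ s * (1 - p) ^ (n - s)) * real (s choose j)" ..
  qed (use j in auto)
  also have "\<dots> = real (n choose j) * p ^ j * (p + (1 - p)) ^ (n - j)"
    by (subst binomial_ring) (simp add: sum_distrib_left)
  finally show ?thesis by simp
qed

text \<open>
  A quadrature rule with \<open>k + 1\<close> nodes is exact in degree at most \<open>k\<close>, hence for the factorial moments
  \<open>s choose j\<close>. If its weights are nonnegative, it is the law of the number of ones of a
  \<open>k\<close>-wise independent vector.
\<close>

lemma max_all_ones_ge_quadrature:
  assumes p: "0 < p" "p < 1" and Z: "Z \<subseteq> {..<n}" "card Z = k"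
    and nonneg: "\<And>x. x \<in> insert n Z \<Longrightarrow>
      (\<Sum>s\<le>n. (real (n choose s) * p ^ s * (1 - p) ^ (n - s)) * lagrange_basis (insert n Z) x (real s)) \<ge> 0"
  shows "max_all_ones n k p
    \<ge> (\<Sum>s\<le>n. (real (n choose s) * p ^ s * (1 - p) ^ (n - s)) * lagrange_basis (insert n Z) n (real s))"
proof -
  define T where "T = insert n Z"
  define \<mu> where "\<mu> s = real (n choose s) * p ^ s * (1 - p) ^ (n - s)" for s
  define w where "w x = (if x \<in> T then \<Sum>s\<le>n. \<mu> s * lagrange_basis T x (real s) else 0)" for x
  have T: "finite T" "card T = Suc k" "T \<subseteq> {..n}"
    using Z finite_subset[OF Z(1)] by (auto simp: T_def card_insert_if)
  have quadrature: "(\<Sum>s\<le>n. w s * poly P (real s)) = (\<Sum>s\<le>n. \<mu> s * poly P (real s))"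
    if "degree P \<le> k" for P
  proof -
    have "(\<Sum>s\<le>n. w s * poly P (real s)) = (\<Sum>x\<in>T. w x * poly P (real x))"
      using T by (intro sum.mono_neutral_right) (auto simp: w_def)
    also have "\<dots> = (\<Sum>x\<in>T. \<Sum>s\<le>n. \<mu> s * (poly P (real x) * lagrange_basis T x (real s)))"
      by (intro sum.cong) (auto simp: w_def sum_distrib_left ac_simps)
    also have "\<dots> = (\<Sum>s\<le>n. \<mu> s * (\<Sum>x\<in>T. poly P (real x) * lagrange_basis T x (real s)))"
      by (subst sum.swap) (simp add: sum_distrib_left)
    also have "\<dots> = (\<Sum>s\<le>n. \<mu> s * poly P (real s))"
      using that T(2) by (simp flip: lagrange_interpolation[OF T(1)])
    finally show ?thesis .
  qed
  have "w n \<le> max_all_ones n k p"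
  proof (rule max_all_ones_ge_factorial_moments)
    show "w s \<ge> 0" for s using nonneg by (auto simp: w_def \<mu>_def T_def)
  next
    fix j assume j: "j \<le> k" "j \<le> n"
    define P :: "real poly" where "P = smult (1 / fact j) (\<Prod>i\<in>{0..<j}. [:- real i, 1:])"
    have "degree (\<Prod>i\<in>{0..<j}. [:- real i, 1:]) \<le> (\<Sum>i\<in>{0..<j}. 1)"
      by (rule order.trans[OF degree_prod_sum_le]) auto
    then have "degree P \<le> k" using j by (simp add: P_def)
    have poly_P: "poly P (real s) = real (s choose j)" for s
      by (simp add: P_def poly_prod binomial_gbinomial gbinomial_prod_rev)
    show "(\<Sum>s\<le>n. w s * real (s choose j)) = real (n choose j) * p ^ j"
      using quadrature[OF \<open>degree P \<le> k\<close>] binomial_factorial_moment[OF j(2), of p]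
      by (simp add: poly_P \<mu>_def)
  qed
  then show ?thesis by (simp add: w_def T_def \<mu>_def)
qed

section \<open>Comparison of the two maxima\<close>

lemma prod_distances_to_others:
  assumes "s \<le> n"
  shows "(\<Prod>j\<in>{..n} - {s}. \<bar>real s - real j\<bar>) = fact s * fact (n - s)"
proof -
  have "(\<Prod>j\<in>{..<s}. \<bar>real s - real j\<bar>) = (\<Prod>i\<in>{1..s}. real i)"
    by (rule prod.reindex_bij_witness[of _ "\<lambda>i. s - i" "\<lambda>j. s - j"]) auto
  moreover have "(\<Prod>j\<in>{s<..n}. \<bar>real s - real j\<bar>) = (\<Prod>i\<in>{1..n - s}. real i)"
    by (rule prod.reindex_bij_witness[of _ "\<lambda>i. s + i" "\<lambda>j. j - s"]) auto
  moreover have "(\<Prod>j\<in>{..<s} \<union> {s<..n}. \<bar>real s - real j\<bar>)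
      = (\<Prod>j\<in>{..<s}. \<bar>real s - real j\<bar>) * (\<Prod>j\<in>{s<..n}. \<bar>real s - real j\<bar>)"
    by (intro prod.union_disjoint) auto
  moreover have "{..n} - {s} = {..<s} \<union> {s<..n}" using assms by auto
  ultimately show ?thesis by (simp only: fact_prod of_nat_prod)
qed

lemma binomial_weight_eq_weight:
  assumes p: "0 < p" "p < 1" and s: "s \<le> n"
  shows "real (n choose s) * p ^ s * (1 - p) ^ (n - s)
    = fact n * (1 - p) ^ n * weight (p / (1 - p)) {..n} s"
proof -
  have "(1 - p) ^ n = (1 - p) ^ s * (1 - p) ^ (n - s)" using s by (simp flip: power_add)
  then show ?thesis
    using p s by (simp add: weight_def prod_distances_to_others binomial_fact power_divide)
qed

lemma prod_adjacent_pairs: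
  fixes g :: "nat \<Rightarrow> 'a :: comm_monoid_mult"
  assumes "finite Y" "Y \<inter> Suc ` Y = {}"
  shows "(\<Prod>j\<in>Y \<union> Suc ` Y. g j) = (\<Prod>y\<in>Y. g y * g (Suc y))"
  using assms by (simp add: prod.union_disjoint prod.reindex prod.distrib o_def)

text \<open>
  The comparison described at the beginning. With \<open>S\<close> the sum of the weights over \<open>F\<close>, the points
  of \<open>F\<close> contribute at most \<open>exp (1/2) * S\<close> to the sum of \<open>\<mu> * q\<^sup>2\<close>. Those of \<open>Z\<close> contribute at most
  \<open>exp (1/2) * (k / 2) * S\<close>, with the factor \<open>1/4\<close> from the half-unit distance to the own
  midpoint. Finally \<open>1 + k / 2 \<le> k\<close> for \<open>k \<ge> 2\<close>.
\<close>

lemma max_top_mass_le_max_all_ones: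
  assumes p: "0 < p" "p < 1" and k: "even k" "1 \<le> k" "real k \<le> real n * p"
  shows "max_top_mass n k p \<le> exp (1/2) * real k * max_all_ones n k p"
proof -
  define \<mu> where "\<mu> s = real (n choose s) * p ^ s * (1 - p) ^ (n - s)" for s
  have \<mu>_nonneg: "\<mu> s \<ge> 0" for s using p by (simp add: \<mu>_def)
  have "real n * p \<le> real n" using p by (simp add: mult_left_le)
  then have "k \<le> n" using k by linarith
  obtain Z where Z: "Z \<subseteq> {..<n}" "card Z = k"
    and nonneg: "\<And>s. s \<le> n \<Longrightarrow> (\<Prod>z\<in>Z. real s - real z) \<ge> 0"
    and weights: "\<And>x. x \<in> insert n Z \<Longrightarrow> (\<Sum>s\<le>n. \<mu> s * lagrange_basis (insert n Z) x (real s)) \<ge> 0"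
    using extremal_quadrature[of n \<mu> k] \<mu>_nonneg \<open>k \<le> n\<close> by blast
  obtain Y where Y: "Z = Y \<union> Suc ` Y" "Y \<inter> Suc ` Y = {}"
    using zeros_in_adjacent_pairs[OF Z(1) _ nonneg] Z(2) k(1) by blast
  have fin_Z: "finite Z" using Z(1) finite_subset by blast
  have fin_Y: "finite Y" using fin_Z Y by simp
  define f where "f s = (\<Prod>z\<in>Z. real s - real z)" for s
  define q where "q = (\<Prod>y\<in>Y. [:- (real y + 1/2), 1:])"
  have poly_q: "(poly q (real s))\<^sup>2 = (\<Prod>y\<in>Y. (real s - real y - 1/2)\<^sup>2)" for s
    by (simp add: q_def poly_prod prod_power_distrib algebra_simps)
  have "card Z = card Y + card (Suc ` Y)" unfolding Y(1) using fin_Y Y(2) by (intro card_Un_disjoint) auto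
  then have card_Y: "2 * card Y = k" using Z(2) by (simp add: card_image)
  have deg_q: "2 * degree q \<le> k"
  proof -
    have "degree q \<le> (\<Sum>y\<in>Y. 1)"
      unfolding q_def by (rule order.trans[OF degree_prod_sum_le]) (use fin_Y in auto)
    then show ?thesis using card_Y by simp
  qed
  define F where "F = {..n} - Z"
  define r where "r = p / (1 - p)"
  define G where "G = fact n * (1 - p) ^ n"
  have r: "r > 0" "real k \<le> real n * r"
  proof -
    have "p \<le> r" using p by (simp add: r_def field_simps)
    then show "real k \<le> real n * r" using k(3) mult_left_mono[of p r "real n"] by linarith
  qed (use p in \<open>simp add: r_def\<close>)
  have G_pos: "G > 0" using p by (simp add: G_def)
  have \<mu>_full: "\<mu> s = G * weight r {..n} s" if "s \<le> n" for s
    unfolding \<mu>_def G_def r_def using binomial_weight_eq_weight[OF p that] .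
  have n_Z: "{..n} = F \<union> Z" "F \<inter> Z = {}" using Z by (auto simp: F_def)
  have fin_F: "finite F" by (simp add: F_def)

  \<comment> \<open>Off \<open>Z\<close>, the distances to the points of \<open>Z\<close> in the binomial weight cancel against \<open>f\<close>.\<close>
  have \<mu>_F: "\<mu> s * f s = G * weight r F s" if "s \<in> F" for s
  proof -
    have "s \<le> n" "s \<notin> Z" using that by (auto simp: F_def)
    have "{..n} - {s} = (F - {s}) \<union> Z" "(F - {s}) \<inter> Z = {}" using n_Z \<open>s \<notin> Z\<close> by auto
    moreover have "f s = (\<Prod>z\<in>Z. \<bar>real s - real z\<bar>)"
      using nonneg[OF \<open>s \<le> n\<close>] by (simp add: f_def abs_prod[symmetric])
    ultimately have "(\<Prod>j\<in>{..n} - {s}. \<bar>real s - real j\<bar>) = (\<Prod>j\<in>F - {s}. \<bar>real s - real j\<bar>) * f s"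
      using fin_F fin_Z by (simp only: prod.union_disjoint finite_Diff)
    moreover have "f s \<noteq> 0" using \<open>s \<notin> Z\<close> fin_Z by (auto simp: f_def)
    ultimately show ?thesis by (simp add: \<mu>_full[OF \<open>s \<le> n\<close>] weight_def)
  qed
  have f_pairs: "f s = (\<Prod>y\<in>Y. (real s - real y) * (real s - real y - 1))" for s
    unfolding f_def Y(1) prod_adjacent_pairs[OF fin_Y Y(2)] by (simp add: algebra_simps)
  have q_F: "(poly q (real s))\<^sup>2 \<le> exp (1/2) * f s" if "s \<in> F" for s
    unfolding poly_q f_pairs
    by (rule midpoint_square_le[OF fin_Y]) (use that Y in \<open>auto simp: F_def\<close>)

  \<comment> \<open>At \<open>z \<in> Z\<close> they cancel against \<open>q\<^sup>2\<close>, where the distance \<open>1\<close> to the partner \<open>z'\<close> of \<open>z\<close> does not count.\<close>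
  have q_Z: "\<mu> z * (poly q (real z))\<^sup>2 \<le> exp (1/2) / 4 * (G * weight r F z)" if z: "z \<in> Z" for z
  proof -
    have "z \<le> n" "z \<notin> F" using z Z by (auto simp: F_def)
    obtain y where y: "y \<in> Y" "z = y \<or> z = Suc y" using z Y by auto
    define z' where "z' = (if z = y then Suc y else y)"
    define Y' where "Y' = Y - {y}"
    have Y': "finite Y'" "Y' \<inter> Suc ` Y' = {}" "z \<notin> Y'" "z \<notin> Suc ` Y'"
      using fin_Y Y(2) y by (auto simp: Y'_def)
    have Z_z: "Z - {z} = insert z' (Y' \<union> Suc ` Y')" "z' \<notin> Y' \<union> Suc ` Y'"
      using Y y by (auto simp: z'_def Y'_def)
    have "(\<Prod>j\<in>Z - {z}. \<bar>real z - real j\<bar>) = (\<Prod>j\<in>Y' \<union> Suc ` Y'. \<bar>real z - real j\<bar>)"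
      unfolding Z_z(1) using Z_z(2) Y'(1) y by (subst prod.insert) (auto simp: z'_def)
    also have "\<dots> = (\<Prod>y\<in>Y'. \<bar>(real z - real y) * (real z - real y - 1)\<bar>)"
      unfolding prod_adjacent_pairs[OF Y'(1,2)] by (simp add: abs_mult diff_diff_eq add.commute)
    finally have prod_Z: "(\<Prod>j\<in>Z - {z}. \<bar>real z - real j\<bar>)
      = (\<Prod>y\<in>Y'. \<bar>(real z - real y) * (real z - real y - 1)\<bar>)" .
    have "(poly q (real z))\<^sup>2 = (real z - real y - 1/2)\<^sup>2 * (\<Prod>y\<in>Y'. (real z - real y - 1/2)\<^sup>2)"
      unfolding poly_q Y'_def using fin_Y y(1) by (simp add: prod.remove)
    also have "(real z - real y - 1/2)\<^sup>2 = 1/4"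
      using y(2) by (auto simp: power2_eq_square)
    also have "1/4 * (\<Prod>y\<in>Y'. (real z - real y - 1/2)\<^sup>2)
      \<le> 1/4 * (exp (1/2) * (\<Prod>y\<in>Y'. (real z - real y) * (real z - real y - 1)))"
      using midpoint_square_le[OF Y'(1,3,4)] by simp
    also have "\<dots> \<le> exp (1/2) / 4 * (\<Prod>j\<in>Z - {z}. \<bar>real z - real j\<bar>)"
      unfolding prod_Z using abs_ge_self[of "\<Prod>y\<in>Y'. (real z - real y) * (real z - real y - 1)"]
      by (simp add: abs_prod)
    finally have "\<mu> z * (poly q (real z))\<^sup>2
      \<le> \<mu> z * (exp (1/2) / 4 * (\<Prod>j\<in>Z - {z}. \<bar>real z - real j\<bar>))"
      using \<mu>_nonneg by (intro mult_left_mono)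
    also have "{..n} - {z} = F \<union> (Z - {z})" using n_Z \<open>z \<notin> F\<close> by auto
    then have "(\<Prod>j\<in>{..n} - {z}. \<bar>real z - real j\<bar>)
      = (\<Prod>j\<in>F. \<bar>real z - real j\<bar>) * (\<Prod>j\<in>Z - {z}. \<bar>real z - real j\<bar>)"
      using fin_F fin_Z n_Z(2) by (simp add: prod.union_disjoint Diff_Int_distrib)
    then have "\<mu> z * (exp (1/2) / 4 * (\<Prod>j\<in>Z - {z}. \<bar>real z - real j\<bar>))
      = exp (1/2) / 4 * (G * weight r F z)"
      using \<open>z \<notin> F\<close> fin_Z by (simp add: \<mu>_full[OF \<open>z \<le> n\<close>] weight_def mult_ac)
    finally show ?thesis .
  qed

  define S where "S = (\<Sum>s\<in>F. weight r F s)"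
  have S: "S \<ge> 0" unfolding S_def using r by (intro sum_nonneg less_imp_le[OF weight_pos])
  have k2: "k \<ge> 2" using k by (cases "k = 1") auto
  have "(\<Sum>s\<le>n. \<mu> s * f s) = (\<Sum>s\<in>F. \<mu> s * f s)"
    by (rule sum.mono_neutral_right) (use fin_Z in \<open>auto simp: F_def f_def\<close>)
  also have "\<dots> = G * S" by (simp add: \<mu>_F S_def sum_distrib_left)
  finally have sum_f: "(\<Sum>s\<le>n. \<mu> s * f s) = G * S" .
  have "(\<Sum>s\<le>n. \<mu> s * (poly q (real s))\<^sup>2)
     = (\<Sum>s\<in>F. \<mu> s * (poly q (real s))\<^sup>2) + (\<Sum>z\<in>Z. \<mu> z * (poly q (real z))\<^sup>2)"
    unfolding n_Z(1) using fin_F fin_Z n_Z(2) by (intro sum.union_disjoint)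
  also have "(\<Sum>s\<in>F. \<mu> s * (poly q (real s))\<^sup>2) \<le> (\<Sum>s\<in>F. exp (1/2) * (G * weight r F s))"
  proof (intro sum_mono)
    fix s assume "s \<in> F"
    have "\<mu> s * (poly q (real s))\<^sup>2 \<le> \<mu> s * (exp (1/2) * f s)"
      using \<mu>_nonneg q_F[OF \<open>s \<in> F\<close>] by (intro mult_left_mono)
    also have "\<dots> = exp (1/2) * (\<mu> s * f s)" by simp
    also have "\<dots> = exp (1/2) * (G * weight r F s)" unfolding \<mu>_F[OF \<open>s \<in> F\<close>] ..
    finally show "\<mu> s * (poly q (real s))\<^sup>2 \<le> exp (1/2) * (G * weight r F s)" .
  qed
  also have "\<dots> = exp (1/2) * (G * S)" by (simp add: S_def sum_distrib_left)
  also have "(\<Sum>z\<in>Z. \<mu> z * (poly q (real z))\<^sup>2) \<le> (\<Sum>z\<in>Z. exp (1/2) / 4 * (G * weight r F z))"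
    by (intro sum_mono q_Z)
  also have "\<dots> = exp (1/2) / 4 * G * (\<Sum>z\<in>Z. weight r F z)" by (simp add: sum_distrib_left mult.assoc)
  also have "\<dots> \<le> exp (1/2) / 4 * G * (2 * real k * S)"
    unfolding S_def F_def using G_pos by (intro mult_left_mono sum_weight_gaps_le Z k r) auto
  also have "exp (1/2) * (G * S) + exp (1/2) / 4 * G * (2 * real k * S)
      = exp (1/2) * (1 + real k / 2) * (G * S)" by (simp add: algebra_simps)
  also have "\<dots> \<le> exp (1/2) * real k * (G * S)"
    using S G_pos k2 by (intro mult_right_mono mult_left_mono) auto
  finally have sum_q: "(\<Sum>s\<le>n. \<mu> s * (poly q (real s))\<^sup>2) \<le> exp (1/2) * real k * (G * S)" by simp

  have lt_n: "Suc y < n" if "y \<in> Y" for y using that Y(1) Z(1) by auto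
  have f_n: "f n > 0" unfolding f_def using Z(1) by (intro prod_pos) auto
  have f_q: "f n \<le> (poly q (real n))\<^sup>2"
    unfolding f_pairs poly_q
  proof (intro prod_mono conjI)
    fix y assume "y \<in> Y"
    then show "0 \<le> (real n - real y) * (real n - real y - 1)"
      using lt_n[of y] by (intro mult_nonneg_nonneg) auto
  qed (simp add: power2_eq_square algebra_simps)
  have "max_top_mass n k p \<le> (\<Sum>s\<le>n. \<mu> s * (poly q (real s))\<^sup>2) / (poly q (real n))\<^sup>2"
    using max_top_mass_le[OF p deg_q] f_n f_q p
    by (force simp: expectation_binomial \<mu>_def)
  also have "\<dots> \<le> exp (1/2) * real k * (G * S) / f n"
    using sum_q f_q f_n G_pos S by (intro frac_le) auto
  also have "\<dots> = exp (1/2) * real k * (\<Sum>s\<le>n. \<mu> s * lagrange_basis (insert n Z) n (real s))"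
  proof -
    have "lagrange_basis (insert n Z) n (real s) = f s / f n" for s
      using Z(1) by (auto simp: lagrange_basis_def f_def prod_dividef intro!: arg_cong2[where f = "(/)"] prod.cong)
    then show ?thesis by (simp add: sum_f sum_divide_distrib[symmetric])
  qed
  also have "\<dots> \<le> exp (1/2) * real k * max_all_ones n k p"
    using max_all_ones_ge_quadrature[OF p Z] weights by (intro mult_left_mono) (auto simp: \<mu>_def)
  finally show ?thesis .
qed

lemma max_top_mass_nonneg:
  assumes "0 < p" "p < 1"
  shows "max_top_mass n k p \<ge> 0"
proof -
  obtain D where "D \<in> moment_laws n k p" using moment_laws_nonempty[OF assms] by blast
  then show ?thesis unfolding max_top_mass_def
    by (rule cSUP_upper2[OF bdd_above_moment_laws]) simp
qed

lemma max_all_ones_ge_factor: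
  assumes p: "0 < p" "p < 1" and k: "even k" "1 \<le> k" "real k \<le> real n * p * (1 - p) - 1"
    and a: "a \<le> 1 / (2 * real k)"
  shows "max_all_ones n k p \<ge> a * max_top_mass n k p"
proof -
  have "real n * p * (1 - p) \<le> real n * p" using p by (simp add: mult_left_le)
  then have le: "max_top_mass n k p \<le> exp (1/2) * real k * max_all_ones n k p"
    using k by (intro max_top_mass_le_max_all_ones p) auto
  have "exp (1/2) \<le> (2::real)"
  proof -
    have "exp (1/2 :: real) ^ 2 = exp 1" by (simp flip: exp_of_nat_mult)
    also have "\<dots> \<le> 2 ^ 2" using exp_le by simp
    finally show ?thesis by (rule power2_le_imp_le) simp
  qed
  note top = max_top_mass_nonneg[OF p, of n k]
  have "a * max_top_mass n k p \<le> 1 / (2 * real k) * max_top_mass n k p"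
    using a top by (rule mult_right_mono)
  also have "\<dots> \<le> 1 / (exp (1/2) * real k) * max_top_mass n k p"
    using k \<open>exp (1/2) \<le> 2\<close> top by (intro mult_right_mono divide_left_mono) auto
  also have "\<dots> \<le> max_all_ones n k p"
    using le k by (simp add: divide_le_eq mult.commute)
  finally show ?thesis .
qed

text \<open>
  Since \<open>ln (ln (2 * x)) \<le> ln x\<close>, the inner exponential with the constant \<open>1/2\<close> is at most \<open>sqrt x\<close>,
  and \<open>exp (- sqrt x)\<close> decays faster than \<open>1 / x\<close>.
\<close>

lemma subpolynomial_decay_le_inverse:
  fixes x :: real
  assumes x: "x \<ge> 2"
  shows "1/4 * exp (- (x / exp (1/2 * sqrt (ln x * ln (ln (2 * x)))))) \<le> 1 / (2 * x)"
proof -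
  have "ln (2 * x) > 0" using x by simp
  then have "ln (ln (2 * x)) \<le> ln (2 * x) - 1" by (rule ln_le_minus_one)
  also have "\<dots> = ln 2 + ln x - 1" using x by (simp add: ln_mult)
  also have "\<dots> \<le> ln x" using ln_le_minus_one[of "2::real"] by simp
  finally have "ln x * ln (ln (2 * x)) \<le> (ln x)\<^sup>2"
    using x by (simp add: power2_eq_square mult_left_mono)
  then have "sqrt (ln x * ln (ln (2 * x))) \<le> ln x"
    using x by (intro real_le_lsqrt) auto
  then have "exp (1/2 * sqrt (ln x * ln (ln (2 * x)))) \<le> exp (1/2 * ln x)" by simp
  also have "\<dots> = sqrt x" using x by (simp add: powr_half_sqrt[symmetric] powr_def)
  finally have "x / sqrt x \<le> x / exp (1/2 * sqrt (ln x * ln (ln (2 * x))))"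
    using x by (intro divide_left_mono) auto
  then have ge: "sqrt x \<le> x / exp (1/2 * sqrt (ln x * ln (ln (2 * x))))"
    using x by (simp add: real_div_sqrt)
  have "0 \<le> sqrt x" "1 + sqrt x + x / 2 \<le> exp (sqrt x)"
    using exp_lower_Taylor_quadratic[of "sqrt x"] x by auto
  then have "x / 2 \<le> exp (sqrt x)" by linarith
  also have "\<dots> \<le> exp (x / exp (1/2 * sqrt (ln x * ln (ln (2 * x)))))" using ge by simp
  finally show ?thesis using x by (simp add: exp_minus field_simps)
qed

theorem corollary1p2:
  "\<exists>C c :: real. C > 0 \<and> c > 0 \<and>
     (\<forall>m::real. m > 0 \<longrightarrow>
        (\<exists>N0::real. \<forall>(n::nat) (k::nat) (p::real).
           n \<ge> 1 \<and> k \<ge> 1 \<and> even k \<and> 0 < p \<and> p < 1 \<longrightarrow>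
           (let N = real n * p * (1 - p) - 1 in
              N > N0 \<and> real k \<le> (ln N) powr m \<longrightarrow>
              max_all_ones n k p \<ge> c / real k * max_top_mass n k p))) \<and>
     (\<forall>\<beta>::real. 0 < \<beta> \<and> \<beta> < 1 \<longrightarrow>
        (\<exists>(c\<beta>::real) (N0::real). c\<beta> > 0 \<and>
           (\<forall>(n::nat) (k::nat) (p::real).
              n \<ge> 1 \<and> k \<ge> 1 \<and> even k \<and> 0 < p \<and> p < 1 \<longrightarrow>
              (let N = real n * p * (1 - p) - 1 in
                 N > N0 \<and> real k \<le> N powr \<beta> \<longrightarrow>
                 max_all_ones n k p \<ge>
                   c * exp (- (real k / exp (c\<beta> * sqrt (ln (real k) * ln (ln (2 * real k))))))
                     * max_top_mass n k p)))) \<and>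
     (\<forall>(n::nat) (k::nat) (p::real).
        n \<ge> 1 \<and> k \<ge> 1 \<and> even k \<and> 0 < p \<and> p < 1 \<longrightarrow>
        (let N = real n * p * (1 - p) - 1 in
           real k \<le> c * N \<longrightarrow>
           max_all_ones n k p \<ge> c * exp (- C * real k) * max_top_mass n k p))"
  unfolding Let_def
proof (rule exI[of _ "1::real"], rule exI[of _ "1/4::real"], intro conjI allI impI)
  fix m :: real
  have "eventually (\<lambda>N::real. ln N powr m \<le> N) at_top" by real_asymp
  then obtain N0 where N0: "\<And>N. N \<ge> N0 \<Longrightarrow> ln N powr m \<le> N"
    by (auto simp: eventually_at_top_linorder)
  show "\<exists>N0::real. \<forall>(n::nat) (k::nat) (p::real).
           n \<ge> 1 \<and> k \<ge> 1 \<and> even k \<and> 0 < p \<and> p < 1 \<longrightarrow>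
              real n * p * (1 - p) - 1 > N0 \<and> real k \<le> (ln (real n * p * (1 - p) - 1)) powr m \<longrightarrow>
              max_all_ones n k p \<ge> (1/4) / real k * max_top_mass n k p"
  proof (intro exI[of _ N0] allI impI, elim conjE)
    fix n k :: nat and p :: real
    assume *: "k \<ge> 1" "even k" "0 < p" "p < 1" "real n * p * (1 - p) - 1 > N0"
      "real k \<le> (ln (real n * p * (1 - p) - 1)) powr m"
    show "max_all_ones n k p \<ge> (1/4) / real k * max_top_mass n k p"
      using * N0[of "real n * p * (1 - p) - 1"]
      by (intro max_all_ones_ge_factor) (auto simp: divide_simps)
  qed
next
  fix \<beta> :: real assume \<beta>: "0 < \<beta> \<and> \<beta> < 1"
  show "\<exists>(c\<beta>::real) (N0::real). c\<beta> > 0 \<and>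
           (\<forall>(n::nat) (k::nat) (p::real).
              n \<ge> 1 \<and> k \<ge> 1 \<and> even k \<and> 0 < p \<and> p < 1 \<longrightarrow>
                 real n * p * (1 - p) - 1 > N0 \<and> real k \<le> (real n * p * (1 - p) - 1) powr \<beta> \<longrightarrow>
                 max_all_ones n k p \<ge>
                   1/4 * exp (- (real k / exp (c\<beta> * sqrt (ln (real k) * ln (ln (2 * real k))))))
                     * max_top_mass n k p)"
  proof (rule exI[of _ "1/2::real"], rule exI[of _ "1::real"], intro conjI allI impI, goal_cases)
    case (2 n k p)
    define N where "N = real n * p * (1 - p) - 1"
    have "k \<ge> 2" using 2 by (cases "k = 1") auto
    \<comment> \<open>The threshold \<open>N0 = 1\<close> is there for this step.\<close>
    have "N powr \<beta> \<le> N powr 1" using 2 \<beta> by (intro powr_mono) (auto simp: N_def)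
    then have "real k \<le> N" using 2 by (simp add: N_def)
    then show ?case
      using 2 \<open>k \<ge> 2\<close> subpolynomial_decay_le_inverse[of "real k"]
      by (intro max_all_ones_ge_factor) (auto simp: N_def)
  qed simp
next
  fix n k :: nat and p :: real
  assume *: "n \<ge> 1 \<and> k \<ge> 1 \<and> even k \<and> 0 < p \<and> p < 1"
    and k: "real k \<le> 1/4 * (real n * p * (1 - p) - 1)"
  have "1/4 * exp (- 1 * real k) \<le> 1 / (2 * real k)"
  proof -
    have "real k \<le> exp (real k)" using exp_ge_add_one_self[of "real k"] by linarith
    then show ?thesis using * by (simp add: exp_minus field_simps)
  qed
  then show "max_all_ones n k p \<ge> 1/4 * exp (- 1 * real k) * max_top_mass n k p"
    using * k by (intro max_all_ones_ge_factor) auto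
qed simp_all

end
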